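(* Let $\mathcal{D}$ be a set. The linear map $$\Psi:(\mathit{CP}(\mathcal{D}),\bullet,\cdot)\longrightarrow(\mathit{CP}(\mathcal{D}),\diamond,\cdot),\qquad \Psi(T)=\sum_{T'\leqslant T}T'\quad\text{for } T\in\mathcal{PT}(\mathcal{D}),$$ is an isomorphism of Com-PreLie algebras.
   Context: $\mathbb{K}$ is a field of characteristic zero. A Com-PreLie algebra is a vector space $A$ with bilinear products $\cdot,\bullet$ such that $\cdot$ is associative and commutative, $(a\bullet b)\bullet c-a\bullet(b\bullet c)=(a\bullet c)\bullet b-a\bullet(c\bullet b)$ and $(a\cdot b)\bullet c=(a\bullet c)\cdot b+a\cdot(b\bullet c)$ for all $a,b,c$. A partitioned forest is a rooted forest $F$ with vertex set $V(F)$, edges oriented from the roots to the leaves, together with a partition of $V(F)$ into blocks such that two vertices in the same block are either both roots or have the same parent. It is a partitioned tree if all its roots lie in one block; the empty forest $\emptyset$ is a partitioned tree. $\mathcal{PT}(\mathcal{D})$ is the set of isomorphism classes of partitioned trees (including $\emptyset$) with vertices decorated by $\mathcal{D}$; $\mathit{CP}(\mathcal{D})$ is the vector space with basis $\mathcal{PT}(\mathcal{D})$; $|T|$ is the number of vertices of $T$. $T\cdot T'$ is the disjoint union of $T$ and $T'$ with their two blocks of roots merged into one block; $\emptyset$ is the unit. For a vertex $s$ of $T$, $\mathcal{B}l(s)$ is the set of blocks of $T$ consisting of children of $s$. For $b\in\mathcal{B}l(s)\sqcup\{*\}$, $T\bullet_{s,b}T'$ is obtained by adding edges from $s$ to every root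 of $T'$ and, if $b\in\mathcal{B}l(s)$, merging the block $b$ with the block of roots of $T'$ (if $b=*$, no blocks are merged). The product $\bullet$ is given by $T\bullet T'=\sum_{s\in V(T)}T\bullet_{s,*}T'$ if $T'\neq\emptyset$, and $T\bullet\emptyset=|T|\,T$. The product $\diamond$ is defined by $$T\diamond T'=\sum_{s\in V(T),\ b\in\mathcal{B}l(s)\sqcup\{*\}}T\bullet_{s,b}T'\qquad\text{for all }T,T'\in\mathcal{PT}(\mathcal{D}).$$ For $T=(t,I,d)$ and $T'=(t,I',d)$ in $\mathcal{PT}(\mathcal{D})$ with the same underlying decorated rooted forest $(t,d)$ and partitions $I,I'$ into blocks, $T\leqslant T'$ means that $I'$ is a refinement of $I$; this is a partial order. In the sum defining $\Psi(T)$ for $T=(t,I,d)$, the terms are the $(t,J,d)\in\mathcal{PT}(\mathcal{D})$ with $I$ a refinement of $J$, isomorphic terms being counted with multiplicity.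
   Formalization: For T' = ∅ the product ⋄ is taken to be T ⋄ ∅ = |T| T (only the terms b = * count), since the displayed sum over all b would give 3T instead of 2T for the two-vertex ladder T and Ψ would not preserve the products. *)

theory Defs
  imports Complex_Main "HOL-Library.Poly_Mapping" "HOL-Library.Disjoint_Sets"
begin

section \<open>Com-PreLie algebras\<close>

text \<open>An algebra is a subspace \<open>A\<close> of an ambient vector space with two operations whose laws
  are required on \<open>A\<close> only.\<close>

locale com_prelie_algebra = vector_space scale
  for scale :: "'k::field_char_0 \<Rightarrow> 'a::ab_group_add \<Rightarrow> 'a" +
  fixes A :: "'a set" and dot :: "'a \<Rightarrow> 'a \<Rightarrow> 'a" and bul :: "'a \<Rightarrow> 'a \<Rightarrow> 'a"
  assumes subspace: "subspace A"
    and dot_closed: "\<lbrakk>a \<in> A; b \<in> A\<rbrakk> \<Longrightarrow> dot a b \<in> A"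
    and dot_add_left: "\<lbrakk>a \<in> A; b \<in> A; c \<in> A\<rbrakk> \<Longrightarrow> dot (a + b) c = dot a c + dot b c"
    and dot_add_right: "\<lbrakk>a \<in> A; b \<in> A; c \<in> A\<rbrakk> \<Longrightarrow> dot a (b + c) = dot a b + dot a c"
    and dot_scale_left: "\<lbrakk>a \<in> A; b \<in> A\<rbrakk> \<Longrightarrow> dot (scale r a) b = scale r (dot a b)"
    and dot_scale_right: "\<lbrakk>a \<in> A; b \<in> A\<rbrakk> \<Longrightarrow> dot a (scale r b) = scale r (dot a b)"
    and bul_closed: "\<lbrakk>a \<in> A; b \<in> A\<rbrakk> \<Longrightarrow> bul a b \<in> A"
    and bul_add_left: "\<lbrakk>a \<in> A; b \<in> A; c \<in> A\<rbrakk> \<Longrightarrow> bul (a + b) c = bul a c + bul b c"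
    and bul_add_right: "\<lbrakk>a \<in> A; b \<in> A; c \<in> A\<rbrakk> \<Longrightarrow> bul a (b + c) = bul a b + bul a c"
    and bul_scale_left: "\<lbrakk>a \<in> A; b \<in> A\<rbrakk> \<Longrightarrow> bul (scale r a) b = scale r (bul a b)"
    and bul_scale_right: "\<lbrakk>a \<in> A; b \<in> A\<rbrakk> \<Longrightarrow> bul a (scale r b) = scale r (bul a b)"
    and dot_assoc: "\<lbrakk>a \<in> A; b \<in> A; c \<in> A\<rbrakk> \<Longrightarrow> dot (dot a b) c = dot a (dot b c)"
    and dot_commute: "\<lbrakk>a \<in> A; b \<in> A\<rbrakk> \<Longrightarrow> dot a b = dot b a"
    and prelie: "\<lbrakk>a \<in> A; b \<in> A; c \<in> A\<rbrakk> \<Longrightarrow>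
      bul (bul a b) c - bul a (bul b c) = bul (bul a c) b - bul a (bul c b)"
    and leibniz: "\<lbrakk>a \<in> A; b \<in> A; c \<in> A\<rbrakk> \<Longrightarrow>
      bul (dot a b) c = dot (bul a c) b + dot a (bul b c)"

locale com_prelie_isomorphism =
  dom: com_prelie_algebra scaleA A dotA bulA + cod: com_prelie_algebra scaleB B dotB bulB
  for scaleA :: "'k::field_char_0 \<Rightarrow> 'a::ab_group_add \<Rightarrow> 'a" and A dotA bulA
    and scaleB :: "'k \<Rightarrow> 'b::ab_group_add \<Rightarrow> 'b" and B dotB bulB +
  fixes \<phi> :: "'a \<Rightarrow> 'b"
  assumes bij: "bij_betw \<phi> A B"
    and map_add: "\<lbrakk>a \<in> A; b \<in> A\<rbrakk> \<Longrightarrow> \<phi> (a + b) = \<phi> a + \<phi> b"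
    and map_scale: "a \<in> A \<Longrightarrow> \<phi> (scaleA r a) = scaleB r (\<phi> a)"
    and map_dot: "\<lbrakk>a \<in> A; b \<in> A\<rbrakk> \<Longrightarrow> \<phi> (dotA a b) = dotB (\<phi> a) (\<phi> b)"
    and map_bul: "\<lbrakk>a \<in> A; b \<in> A\<rbrakk> \<Longrightarrow> \<phi> (bulA a b) = bulB (\<phi> a) (\<phi> b)"


section \<open>Partitioned forests and trees\<close>

record ('v, 'd) pforest =
  verts :: "'v set"
  edges :: "('v \<times> 'v) set"   \<comment> \<open>pairs (parent, child)\<close>
  blocks :: "'v set set"
  deco :: "'v \<Rightarrow> 'd"          \<comment> \<open>irrelevant outside \<open>verts\<close>\<close>

definition parents :: "('v, 'd) pforest \<Rightarrow> 'v \<Rightarrow> 'v set" where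
  "parents F v = {s. (s, v) \<in> edges F}"

definition roots :: "('v, 'd) pforest \<Rightarrow> 'v set" where
  "roots F = {v \<in> verts F. parents F v = {}}"

definition rooted_forest :: "('v, 'd) pforest \<Rightarrow> bool" where
  "rooted_forest F \<longleftrightarrow> finite (verts F) \<and> edges F \<subseteq> verts F \<times> verts F \<and>
     acyclic (edges F) \<and> (\<forall>v s s'. s \<in> parents F v \<longrightarrow> s' \<in> parents F v \<longrightarrow> s = s')"

text \<open>In a rooted forest \<open>parents F v\<close> is empty or a singleton, so the equality below says that
  \<open>u\<close> and \<open>v\<close> are both roots or have the same parent.\<close>

definition partitioned_forest :: "('v, 'd) pforest \<Rightarrow> bool" where
  "partitioned_forest F \<longleftrightarrow> rooted_forest F \<and> partition_on (verts F) (blocks F) \<and>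
     (\<forall>B \<in> blocks F. \<forall>u \<in> B. \<forall>v \<in> B. parents F u = parents F v)"

definition partitioned_tree :: "('v, 'd) pforest \<Rightarrow> bool" where
  "partitioned_tree T \<longleftrightarrow> partitioned_forest T \<and>
     (\<forall>B \<in> blocks T. \<forall>u \<in> roots T. \<forall>v \<in> roots T. u \<in> B \<longrightarrow> v \<in> B)"

definition pf_iso :: "('v, 'd) pforest \<Rightarrow> ('w, 'd) pforest \<Rightarrow> bool" where
  "pf_iso F G \<longleftrightarrow> (\<exists>f. bij_betw f (verts F) (verts G) \<and>
     edges G = map_prod f f ` edges F \<and> blocks G = (`) f ` blocks F \<and>
     (\<forall>v \<in> verts F. deco G (f v) = deco F v))"

text \<open>Every finite forest is isomorphic to one with natural numbers as vertices, so an isomorphism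
  class is represented by the set of its members over \<^typ>\<open>nat\<close>.\<close>

type_synonym 'd pclass = "(nat, 'd) pforest set"

definition iso_class :: "('v, 'd) pforest \<Rightarrow> 'd pclass" where
  "iso_class F = {G. pf_iso F G}"

definition rep :: "'d pclass \<Rightarrow> (nat, 'd) pforest" where
  "rep X = (SOME F. F \<in> X)"

definition PT :: "'d set \<Rightarrow> 'd pclass set" where
  "PT D = {iso_class T |T :: (nat, 'd) pforest. partitioned_tree T \<and> deco T ` verts T \<subseteq> D}"

definition merge_roots :: "('v, 'd) pforest \<Rightarrow> ('w, 'd) pforest \<Rightarrow> ('v + 'w, 'd) pforest" where
  "merge_roots T T' = \<lparr>
     verts = verts T <+> verts T',
     edges = map_prod Inl Inl ` edges T \<union> map_prod Inr Inr ` edges T',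
     blocks = (`) Inl ` (blocks T - {roots T}) \<union> (`) Inr ` (blocks T' - {roots T'}) \<union>
       ({roots T <+> roots T'} - {{}}),
     deco = case_sum (deco T) (deco T')\<rparr>"

definition Bl :: "('v, 'd) pforest \<Rightarrow> 'v \<Rightarrow> 'v set set" where
  "Bl T s = {B \<in> blocks T. \<forall>v \<in> B. (s, v) \<in> edges T}"

text \<open>\<open>graft T s b T'\<close> is \<open>T \<bullet>\<^bsub>s,b\<^esub> T'\<close>, with \<^const>\<open>None\<close> in the role of \<open>*\<close>.\<close>

definition graft ::
  "('v, 'd) pforest \<Rightarrow> 'v \<Rightarrow> 'v set option \<Rightarrow> ('w, 'd) pforest \<Rightarrow> ('v + 'w, 'd) pforest" where
  "graft T s b T' = \<lparr>
     verts = verts T <+> verts T',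
     edges = map_prod Inl Inl ` edges T \<union> map_prod Inr Inr ` edges T' \<union>
       {(Inl s, Inr r) |r. r \<in> roots T'},
     blocks = (case b of
         None \<Rightarrow> (`) Inl ` blocks T \<union> (`) Inr ` blocks T'
       | Some B \<Rightarrow> (`) Inl ` (blocks T - {B}) \<union> (`) Inr ` (blocks T' - {roots T'}) \<union>
           {B <+> roots T'}),
     deco = case_sum (deco T) (deco T')\<rparr>"

text \<open>\<open>coarser T' T\<close> is \<open>T' \<le> T\<close>: same decorated forest, blocks of \<open>T\<close> refining those of \<open>T'\<close>.\<close>

definition coarser :: "('v, 'd) pforest \<Rightarrow> ('v, 'd) pforest \<Rightarrow> bool" where
  "coarser T' T \<longleftrightarrow> verts T' = verts T \<and> edges T' = edges T \<and> deco T' = deco T \<and>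
     refines (verts T) (blocks T) (blocks T')"


section \<open>The space of partitioned trees\<close>

definition scale :: "'k::field_char_0 \<Rightarrow> ('x \<Rightarrow>\<^sub>0 'k) \<Rightarrow> ('x \<Rightarrow>\<^sub>0 'k)" where
  "scale r = Poly_Mapping.map ((*) r)"

definition basis :: "'x \<Rightarrow> ('x \<Rightarrow>\<^sub>0 'k::field_char_0)" where
  "basis X = Poly_Mapping.single X 1"

definition lin_ext :: "('x \<Rightarrow> ('y \<Rightarrow>\<^sub>0 'k::field_char_0)) \<Rightarrow> ('x \<Rightarrow>\<^sub>0 'k) \<Rightarrow> ('y \<Rightarrow>\<^sub>0 'k)" where
  "lin_ext f x = (\<Sum>X \<in> Poly_Mapping.keys x. scale (Poly_Mapping.lookup x X) (f X))"

definition bilin_ext ::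
  "('x \<Rightarrow> 'x \<Rightarrow> ('x \<Rightarrow>\<^sub>0 'k::field_char_0)) \<Rightarrow> ('x \<Rightarrow>\<^sub>0 'k) \<Rightarrow> ('x \<Rightarrow>\<^sub>0 'k) \<Rightarrow> ('x \<Rightarrow>\<^sub>0 'k)" where
  "bilin_ext f x y = lin_ext (\<lambda>X. lin_ext (f X) y) x"

text \<open>The operations below are defined on the free space on all \<^typ>\<open>'d pclass\<close> values, of which
  \<open>CP D\<close> is the subspace spanned by \<open>PT D\<close>.\<close>

definition CP :: "'d set \<Rightarrow> ('d pclass \<Rightarrow>\<^sub>0 'k::field_char_0) set" where
  "CP D = {x. Poly_Mapping.keys x \<subseteq> PT D}"

definition cp_dot :: "('d pclass \<Rightarrow>\<^sub>0 'k::field_char_0) \<Rightarrow> ('d pclass \<Rightarrow>\<^sub>0 'k) \<Rightarrow> ('d pclass \<Rightarrow>\<^sub>0 'k)" where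
  "cp_dot = bilin_ext (\<lambda>X Y. basis (iso_class (merge_roots (rep X) (rep Y))))"

definition cp_bullet :: "('d pclass \<Rightarrow>\<^sub>0 'k::field_char_0) \<Rightarrow> ('d pclass \<Rightarrow>\<^sub>0 'k) \<Rightarrow> ('d pclass \<Rightarrow>\<^sub>0 'k)" where
  "cp_bullet = bilin_ext (\<lambda>X Y. let T = rep X; T' = rep Y in
     if verts T' = {} then scale (of_nat (card (verts T))) (basis X)
     else (\<Sum>s \<in> verts T. basis (iso_class (graft T s None T'))))"

text \<open>For the empty \<open>T'\<close> there is no block of roots to merge, so only the terms \<open>b = *\<close>, each equal
  to \<open>T\<close>, contribute, and \<open>T \<diamondop> \<emptyset> = |T| T\<close> as for \<open>\<bullet>\<close>. Counting also the terms with \<open>b\<close> in \<open>Bl T s\<close>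
  would break the pre-Lie identity.\<close>

definition cp_diamond :: "('d pclass \<Rightarrow>\<^sub>0 'k::field_char_0) \<Rightarrow> ('d pclass \<Rightarrow>\<^sub>0 'k) \<Rightarrow> ('d pclass \<Rightarrow>\<^sub>0 'k)" where
  "cp_diamond = bilin_ext (\<lambda>X Y. let T = rep X; T' = rep Y in
     if verts T' = {} then scale (of_nat (card (verts T))) (basis X)
     else (\<Sum>s \<in> verts T. \<Sum>b \<in> insert None (Some ` Bl T s). basis (iso_class (graft T s b T'))))"

definition Psi :: "('d pclass \<Rightarrow>\<^sub>0 'k::field_char_0) \<Rightarrow> ('d pclass \<Rightarrow>\<^sub>0 'k)" where
  "Psi = lin_ext (\<lambda>X. \<Sum>T' | partitioned_tree T' \<and> coarser T' (rep X). basis (iso_class T'))"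

end

theory Submission
  imports Defs
begin

text \<open>The pre-Lie law of \<open>\<bullet>\<close>: in \<open>(a \<bullet> b) \<bullet> c\<close> the graftings of \<open>c\<close> on vertices of \<open>b\<close> cancel
  against \<open>a \<bullet> (b \<bullet> c)\<close>, and the remaining ones, with \<open>b\<close> and \<open>c\<close> both grafted on \<open>a\<close>, are symmetric.
  The map \<open>\<Psi>\<close> is a homomorphism
  because a coarsening of \<open>T \<cdot> T'\<close> or \<open>T \<bullet>\<^bsub>s,*\<^esub> T'\<close> is determined by its restrictions to \<open>T\<close> and \<open>T'\<close>
  and, in the second case, by the block of children of \<open>s\<close> (possibly none) that absorbs the roots of
  \<open>T'\<close>, which is precisely the choice of \<open>b\<close> in \<open>\<diamondop>\<close>. It is unitriangular for the number of blocks,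
  hence bijective, and the \<open>\<diamondop>\<close> laws are transported along it.\<close>

section \<open>Linear extensions\<close>

text \<open>All products and \<open>Psi\<close> are defined through representatives picked by
  \<open>rep\<close>, so no computation can start before each formula on basis elements is known for
  arbitrary trees. These formulas accept any vertex type, which allows the sum types created by one
  product to enter the next. Merging and grafting are both instances of \<open>join\<close>, so one
  bijection between coarsenings yields both homomorphism equations. The sums run over partitions of
  a fixed vertex set and not over classes, which keeps the multiplicity of isomorphic terms. An
  optional block is represented by a possibly empty set throughout. The empty tree is the obstacle:
  it has no block of roots, so every choice of a block of children to absorb its roots gives the
  same coarsening, and it is split off in the grafting case. The laws of \<open>cp_diamond\<close>
  are not checked directly because the blocks available to a second grafting depend on the first
  one.\<close>

lemma lookup_scale: "Poly_Mapping.lookup (scale r x) k = r * Poly_Mapping.lookup x k"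
  by (simp add: scale_def Poly_Mapping.map.rep_eq when_def)

interpretation scale: vector_space scale
  by unfold_locales (auto intro!: poly_mapping_eqI simp: lookup_scale lookup_add algebra_simps)

text \<open>Linearity is stated on the whole free space, without membership conditions; the
  restriction to \<open>PT D\<close> enters only through values on basis elements.\<close>

definition is_lin :: "(('x \<Rightarrow>\<^sub>0 'k::field_char_0) \<Rightarrow> ('y \<Rightarrow>\<^sub>0 'k)) \<Rightarrow> bool" where
  "is_lin F \<longleftrightarrow> (\<forall>x y. F (x + y) = F x + F y) \<and> (\<forall>r x. F (scale r x) = scale r (F x))"

lemma is_linI: "(\<And>x y. F (x + y) = F x + F y) \<Longrightarrow> (\<And>r x. F (scale r x) = scale r (F x)) \<Longrightarrow> is_lin F"
  by (simp add: is_lin_def)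

lemma is_lin_add: "is_lin F \<Longrightarrow> F (x + y) = F x + F y"
  by (simp add: is_lin_def)

lemma is_lin_scale: "is_lin F \<Longrightarrow> F (scale r x) = scale r (F x)"
  by (simp add: is_lin_def)

lemma is_lin_0: "is_lin F \<Longrightarrow> F 0 = 0"
  using is_lin_scale[of F 0 0] by simp

lemma is_lin_sum: "is_lin F \<Longrightarrow> F (sum g S) = (\<Sum>i\<in>S. F (g i))"
  by (induction S rule: infinite_finite_induct) (auto simp: is_lin_0 is_lin_add)

lemma is_lin_diff: "is_lin F \<Longrightarrow> F (x - y) = F x - F y"
  using is_lin_add[of F "x - y" y] by simp

lemma basis_expansion:
  fixes x :: "'x \<Rightarrow>\<^sub>0 'k::field_char_0"
  shows "x = (\<Sum>X\<in>Poly_Mapping.keys x. scale (Poly_Mapping.lookup x X) (basis X))"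
proof (rule poly_mapping_eqI)
  fix k
  show "Poly_Mapping.lookup x k =
      Poly_Mapping.lookup (\<Sum>X\<in>Poly_Mapping.keys x. scale (Poly_Mapping.lookup x X) (basis X)) k"
    by (cases "k \<in> Poly_Mapping.keys x")
      (auto simp: lookup_sum basis_def lookup_single when_def in_keys_iff lookup_scale if_distrib
        sum.delta cong: if_cong)
qed

lemma is_lin_expand:
  "is_lin F \<Longrightarrow> F x = (\<Sum>X\<in>Poly_Mapping.keys x. scale (Poly_Mapping.lookup x X) (F (basis X)))"
  by (subst basis_expansion[of x]) (simp add: is_lin_sum is_lin_scale)

lemma is_lin_eqI:
  assumes "is_lin F" "is_lin G" "Poly_Mapping.keys x \<subseteq> S" "\<And>X. X \<in> S \<Longrightarrow> F (basis X) = G (basis X)"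
  shows "F x = G x"
  unfolding is_lin_expand[OF assms(1), of x] is_lin_expand[OF assms(2), of x]
  using assms(3,4) by (auto intro!: sum.cong)

lemma lin_ext_superset:
  "finite S \<Longrightarrow> Poly_Mapping.keys x \<subseteq> S \<Longrightarrow>
    lin_ext f x = (\<Sum>X\<in>S. scale (Poly_Mapping.lookup x X) (f X))"
  unfolding lin_ext_def by (rule sum.mono_neutral_left) (auto simp: in_keys_iff)

lemma is_lin_lin_ext: "is_lin (lin_ext (f :: 'a \<Rightarrow> 'b \<Rightarrow>\<^sub>0 'c::field_char_0))"
proof (rule is_linI)
  fix x y :: "'a \<Rightarrow>\<^sub>0 'c"
  let ?S = "Poly_Mapping.keys x \<union> Poly_Mapping.keys y"
  show "lin_ext f (x + y) = lin_ext f x + lin_ext f y"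
    using Poly_Mapping.keys_add[of x y]
    by (simp add: lin_ext_superset[of ?S] lookup_scale lookup_add scale.scale_left_distrib sum.distrib)
next
  fix r :: 'c and x :: "'a \<Rightarrow>\<^sub>0 'c"
  show "lin_ext f (scale r x) = scale r (lin_ext f x)"
    using lin_ext_superset[of "Poly_Mapping.keys x" "scale r x" f]
    by (auto simp: lin_ext_def in_keys_iff lookup_scale scale.scale_sum_right subset_iff)
qed

lemma lin_ext_basis [simp]: "lin_ext f (basis X) = f X"
  by (simp add: lin_ext_def basis_def)

lemma is_lin_bilin_left: "is_lin (\<lambda>x. bilin_ext f x y)"
  unfolding bilin_ext_def by (rule is_lin_lin_ext)

lemma is_lin_bilin_right: "is_lin (bilin_ext f x)"
  unfolding bilin_ext_def lin_ext_def[of _ x]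
  by (rule is_linI)
    (simp_all add: is_lin_add[OF is_lin_lin_ext] is_lin_scale[OF is_lin_lin_ext]
      scale.scale_right_distrib sum.distrib scale.scale_sum_right mult.commute)

lemma bilin_ext_basis [simp]: "bilin_ext f (basis X) (basis Y) = f X Y"
  by (simp add: bilin_ext_def)

lemma subspace_CP: "scale.subspace (CP (D :: 'd set) :: ('d pclass \<Rightarrow>\<^sub>0 'k::field_char_0) set)"
  unfolding scale.subspace_def CP_def mem_Collect_eq
proof (intro conjI ballI allI)
  fix x y :: "'d pclass \<Rightarrow>\<^sub>0 'k"
  assume "x \<in> {x. Poly_Mapping.keys x \<subseteq> PT D}" "y \<in> {x. Poly_Mapping.keys x \<subseteq> PT D}"
  then show "Poly_Mapping.keys (x + y) \<subseteq> PT D"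
    using Poly_Mapping.keys_add[of x y] by blast
qed (auto simp: in_keys_iff lookup_scale subset_iff)

lemma basis_in_CP: "X \<in> PT D \<Longrightarrow> basis X \<in> CP D"
  by (simp add: CP_def basis_def)

lemma is_lin_maps_CP:
  assumes "is_lin F" "\<And>X. X \<in> PT D \<Longrightarrow> F (basis X) \<in> CP E" "x \<in> CP D"
  shows "F x \<in> CP E"
  unfolding is_lin_expand[OF assms(1), of x]
  using assms(2,3) by (auto simp: CP_def[of D]
    intro!: scale.subspace_sum[OF subspace_CP] scale.subspace_scale[OF subspace_CP])

section \<open>Isomorphisms of partitioned forests\<close>

text \<open>Exposes the vertex map hidden in \<open>pf_iso\<close>: the transport of roots, blocks
  and coarsenings needs the map itself, not only its existence.\<close>

definition iso_by :: "('v \<Rightarrow> 'w) \<Rightarrow> ('v, 'd) pforest \<Rightarrow> ('w, 'd) pforest \<Rightarrow> bool" where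
  "iso_by f F G \<longleftrightarrow> bij_betw f (verts F) (verts G) \<and>
     edges G = map_prod f f ` edges F \<and> blocks G = (`) f ` blocks F \<and>
     (\<forall>v \<in> verts F. deco G (f v) = deco F v)"

lemma pf_iso_iff: "pf_iso F G \<longleftrightarrow> (\<exists>f. iso_by f F G)"
  by (simp add: pf_iso_def iso_by_def)

lemma iso_by_inj:
  assumes "inj f" "verts G = f ` verts F" "edges G = map_prod f f ` edges F"
    "blocks G = (`) f ` blocks F" "\<And>v. v \<in> verts F \<Longrightarrow> deco G (f v) = deco F v"
  shows "iso_by f F G"
  using assms by (auto simp: iso_by_def bij_betw_def intro: inj_on_subset)

lemma partitioned_forestD:
  assumes "partitioned_forest F"
  shows "finite (verts F)" "edges F \<subseteq> verts F \<times> verts F" "acyclic (edges F)"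
    "partition_on (verts F) (blocks F)"
    "\<And>v s s'. s \<in> parents F v \<Longrightarrow> s' \<in> parents F v \<Longrightarrow> s = s'"
    "\<And>B u v. B \<in> blocks F \<Longrightarrow> u \<in> B \<Longrightarrow> v \<in> B \<Longrightarrow> parents F u = parents F v"
    "\<And>B. B \<in> blocks F \<Longrightarrow> B \<subseteq> verts F" "{} \<notin> blocks F"
proof -
  note * = assms[unfolded partitioned_forest_def rooted_forest_def]
  show "finite (verts F)" "edges F \<subseteq> verts F \<times> verts F" "acyclic (edges F)"
    "partition_on (verts F) (blocks F)"
    using * by simp_all
  then show "\<And>B. B \<in> blocks F \<Longrightarrow> B \<subseteq> verts F" "{} \<notin> blocks F"
    by (auto simp: partition_on_def)
  show "\<And>v s s'. s \<in> parents F v \<Longrightarrow> s' \<in> parents F v \<Longrightarrow> s = s'"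
    "\<And>B u v. B \<in> blocks F \<Longrightarrow> u \<in> B \<Longrightarrow> v \<in> B \<Longrightarrow> parents F u = parents F v"
    using * by blast+
qed

lemma partitioned_treeD: "partitioned_tree T \<Longrightarrow> partitioned_forest T"
  by (simp add: partitioned_tree_def)

lemma iso_by_trans:
  assumes "iso_by f F G" "iso_by g G H"
  shows "iso_by (g \<circ> f) F H"
  unfolding iso_by_def
proof (intro conjI ballI)
  show "bij_betw (g \<circ> f) (verts F) (verts H)"
    using assms by (auto simp: iso_by_def intro: bij_betw_trans)
  show "edges H = map_prod (g \<circ> f) (g \<circ> f) ` edges F"
    using assms by (simp add: iso_by_def image_comp map_prod_compose)
  show "blocks H = (`) (g \<circ> f) ` blocks F"
    using assms by (simp add: iso_by_def image_image image_comp)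
  fix v assume "v \<in> verts F"
  then show "deco H ((g \<circ> f) v) = deco F v"
    using assms by (auto simp: iso_by_def dest: bij_betw_apply)
qed

text \<open>The map \<open>f\<close> is injective on the vertices only; its inverse undoes it on
  edges and blocks because in a partitioned forest both stay inside the vertex set.\<close>

lemma iso_by_sym:
  assumes iso: "iso_by f F G" and F: "partitioned_forest F"
  shows "iso_by (inv_into (verts F) f) G F"
proof -
  let ?g = "inv_into (verts F) f"
  have bij: "bij_betw f (verts F) (verts G)" using iso by (simp add: iso_by_def)
  have gf: "?g (f v) = v" if "v \<in> verts F" for v
    using bij that by (simp add: bij_betw_def)
  have "map_prod ?g ?g ` map_prod f f ` edges F = (\<lambda>x. x) ` edges F"
    unfolding image_image
    by (rule image_cong) (use partitioned_forestD(2)[OF F] gf in auto)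
  moreover have "(`) ?g ` (`) f ` blocks F = (\<lambda>x. x) ` blocks F"
    unfolding image_image
  proof (rule image_cong)
    fix B assume "B \<in> blocks F"
    with partitioned_forestD(7)[OF F] have "B \<subseteq> verts F" by blast
    then have "(\<lambda>x. ?g (f x)) ` B = (\<lambda>x. x) ` B" by (intro image_cong) (use gf in auto)
    then show "(\<lambda>x. ?g (f x)) ` B = B" by simp
  qed simp
  moreover have "deco F (?g w) = deco G w" if "w \<in> verts G" for w
    using that iso gf bij unfolding iso_by_def bij_betw_def by (metis imageE)
  ultimately show ?thesis
    using iso bij_betw_inv_into[OF bij] by (simp add: iso_by_def)
qed

text \<open>The tool behind every equality of basis elements. The vertex types of \<open>F\<close>
  and \<open>G\<close> may differ, since both classes consist of forests over
  \<open>nat\<close>.\<close>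

lemma iso_class_eqI:
  assumes "iso_by f F G" "partitioned_forest F"
  shows "iso_class F = iso_class G"
  unfolding iso_class_def pf_iso_iff
  using iso_by_trans[OF assms(1)] iso_by_trans[OF iso_by_sym[OF assms]] by blast

lemma iso_by_parents:
  assumes iso: "iso_by f F G" and F: "partitioned_forest F" and v: "v \<in> verts F"
  shows "parents G (f v) = f ` parents F v"
proof -
  have inj: "inj_on f (verts F)" and E: "edges G = map_prod f f ` edges F"
    using iso by (auto simp: iso_by_def bij_betw_def)
  have "w = v" if "(s, w) \<in> edges F" "f w = f v" for s w
    using inj_onD[OF inj that(2) _ v] partitioned_forestD(2)[OF F] that(1) by auto
  then show ?thesis
    by (auto simp: parents_def E image_iff) (metis map_prod_simp)
qed

lemma iso_by_roots:
  assumes iso: "iso_by f F G" and F: "partitioned_forest F"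
  shows "roots G = f ` roots F"
proof -
  have "verts G = f ` verts F" using iso by (auto simp: iso_by_def bij_betw_def)
  then show ?thesis
    using iso_by_parents[OF iso F] by (auto simp: roots_def)
qed

lemma parents_subset: "partitioned_forest F \<Longrightarrow> parents F v \<subseteq> verts F"
  using partitioned_forestD(2)[of F] by (auto simp: parents_def)

lemma partition_on_image:
  assumes "partition_on A P" "inj_on f A"
  shows "partition_on (f ` A) ((`) f ` P)"
proof -
  have "(`) f ` P - {{}} = (`) f ` P" using assms(1) by (auto simp: partition_on_def)
  then show ?thesis using partition_on_inj_image[OF assms] by simp
qed

lemma iso_by_partitioned_forest:
  assumes iso: "iso_by f F G" and F: "partitioned_forest F"
  shows "partitioned_forest G"
proof -
  note D = partitioned_forestD[OF F]
  have bij: "inj_on f (verts F)" "verts G = f ` verts F" and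
    E: "edges G = map_prod f f ` edges F" and B: "blocks G = (`) f ` blocks F"
    using iso by (auto simp: iso_by_def bij_betw_def)
  have "acyclic (edges G)"
  proof -
    \<comment> \<open>Acyclicity is moved through well-foundedness: a finite acyclic relation is
      well-founded, and \<open>edges G\<close> lies in the inverse image of \<open>edges F\<close>
      under \<open>?g\<close>.\<close>
    let ?g = "inv_into (verts F) f"
    have sub: "edges G \<subseteq> inv_image (edges F) ?g"
      using D(2) bij(1) by (force simp: E inv_image_def)
    have "wf (edges F)"
      using D(1,2,3) by (auto intro!: finite_acyclic_wf dest: finite_subset)
    then show ?thesis
      using wf_acyclic wf_subset[OF wf_inv_image sub] by blast
  qed
  moreover have "s = s'" if "s \<in> parents G v" "s' \<in> parents G v" for v s s'
  proof -
    have "v \<in> verts G" using that(1) E D(2) bij(2) by (auto simp: parents_def)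
    then obtain w where w: "v = f w" "w \<in> verts F" using bij by auto
    then show ?thesis using that D(5)[of _ w] by (auto simp: iso_by_parents[OF iso F])
  qed
  moreover have "parents G u = parents G v" if "X \<in> blocks G" "u \<in> X" "v \<in> X" for X u v
  proof -
    from that(1) obtain Y where Y: "Y \<in> blocks F" "X = f ` Y" by (auto simp: B)
    with that(2,3) obtain u' v' where "u' \<in> Y" "v' \<in> Y" "u = f u'" "v = f v'" by auto
    then show ?thesis
      using iso_by_parents[OF iso F] Y(1) D(6)[OF Y(1), of u' v'] D(7)[OF Y(1)] by (simp add: subset_iff)
  qed
  moreover have "finite (verts G)" "edges G \<subseteq> verts G \<times> verts G"
    "partition_on (verts G) (blocks G)"
    using D(1,2) partition_on_image[OF D(4) bij(1)] bij(2) by (auto simp: E B)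
  ultimately show ?thesis
    unfolding partitioned_forest_def rooted_forest_def by blast
qed

lemma iso_by_partitioned_tree:
  assumes iso: "iso_by f F G" and F: "partitioned_tree F"
  shows "partitioned_tree G"
  unfolding partitioned_tree_def
proof (intro conjI ballI impI)
  note F' = partitioned_treeD[OF F]
  show "partitioned_forest G" by (rule iso_by_partitioned_forest[OF iso F'])
  fix B u v assume B: "B \<in> blocks G" and uv: "u \<in> roots G" "v \<in> roots G" "u \<in> B"
  have inj: "inj_on f (verts F)" and "blocks G = (`) f ` blocks F"
    using iso by (auto simp: iso_by_def bij_betw_def)
  with B obtain B' where B': "B' \<in> blocks F" "B = f ` B'" by auto
  obtain u' v' where uv': "u = f u'" "v = f v'" "u' \<in> roots F" "v' \<in> roots F"
    using uv iso_by_roots[OF iso F'] by auto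
  have "u' \<in> B'"
    using inj partitioned_forestD(7)[OF F' B'(1)] uv(3) uv' B'(2)
    by (auto simp: roots_def inj_on_def)
  then have "v' \<in> B'" using F B' uv' by (auto simp: partitioned_tree_def)
  then show "v \<in> B" using uv' B' by auto
qed

lemma iso_by_nat:
  assumes "finite (verts (F :: ('v, 'd) pforest))"
  shows "\<exists>f (G :: (nat, 'd) pforest). iso_by f F G"
proof -
  obtain f where f: "inj_on f (verts F)" "f ` verts F \<subseteq> (UNIV :: nat set)"
    using finite_imp_inj_to_nat_seg[OF assms] by blast
  then have "iso_by f F \<lparr>verts = f ` verts F, edges = map_prod f f ` edges F,
      blocks = (`) f ` blocks F, deco = deco F \<circ> inv_into (verts F) f\<rparr>"
    by (simp add: iso_by_def inj_on_imp_bij_betw)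
  then show ?thesis by blast
qed

text \<open>A finite forest has a copy over \<open>nat\<close>, so its class is inhabited and the
  choice in \<open>rep\<close> returns a genuine member.\<close>

lemma rep_iso_class:
  assumes "partitioned_forest F"
  obtains f where "iso_by f F (rep (iso_class F))"
proof -
  have "\<exists>G. G \<in> iso_class F"
    using iso_by_nat[OF partitioned_forestD(1)[OF assms]] by (auto simp: iso_class_def pf_iso_iff)
  then have "rep (iso_class F) \<in> iso_class F" unfolding rep_def by (rule someI_ex)
  then show ?thesis using that by (auto simp: iso_class_def pf_iso_iff)
qed

lemma iso_class_in_PT:
  assumes "partitioned_tree (F :: ('v, 'd) pforest)" "deco F ` verts F \<subseteq> D"
  shows "iso_class F \<in> PT D"
proof -
  obtain f and G :: "(nat, 'd) pforest" where iso: "iso_by f F G"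
    using iso_by_nat[OF partitioned_forestD(1)[OF partitioned_treeD[OF assms(1)]]] by blast
  have "verts G = f ` verts F" "\<forall>v\<in>verts F. deco G (f v) = deco F v"
    using iso by (auto simp: iso_by_def bij_betw_def)
  then have "deco G ` verts G \<subseteq> D" using assms(2) by auto
  then show ?thesis
    using iso_class_eqI[OF iso partitioned_treeD[OF assms(1)]]
      iso_by_partitioned_tree[OF iso assms(1)] unfolding PT_def by blast
qed

section \<open>Gluing partitioned trees\<close>

text \<open>An empty \<open>B\<close> or \<open>C\<close> stands for the absence of a block: with
  \<open>B = {}\<close> the block \<open>C\<close> survives unmerged. The removal of the empty set
  covers the case where both are absent.\<close>

definition glue :: "'v set set \<Rightarrow> 'v set \<Rightarrow> 'w set set \<Rightarrow> 'w set \<Rightarrow> ('v + 'w) set set" where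
  "glue I B J C = (`) Inl ` (I - {B}) \<union> (`) Inr ` (J - {C}) \<union> ({B <+> C} - {{}})"

text \<open>Merging is the case \<open>S = {}\<close>, \<open>B = roots T\<close>; grafting on a vertex \<open>s\<close> is the case \<open>S = {s}\<close>,
  where \<open>B = {}\<close> leaves the block of roots of \<open>T'\<close> unmerged.\<close>

definition join :: "('v, 'd) pforest \<Rightarrow> 'v set \<Rightarrow> 'v set \<Rightarrow> ('w, 'd) pforest \<Rightarrow> ('v + 'w, 'd) pforest" where
  "join T S B T' = \<lparr>
     verts = verts T <+> verts T',
     edges = map_prod Inl Inl ` edges T \<union> map_prod Inr Inr ` edges T' \<union>
       (Inl ` S) \<times> (Inr ` roots T'),
     blocks = glue (blocks T) B (blocks T') (roots T'),
     deco = case_sum (deco T) (deco T')\<rparr>"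

lemma join_simps [simp]:
  "verts (join T S B T') = verts T <+> verts T'"
  "blocks (join T S B T') = glue (blocks T) B (blocks T') (roots T')"
  "deco (join T S B T') = case_sum (deco T) (deco T')"
  by (simp_all add: join_def)

text \<open>The possible values of \<open>B\<close> in \<^term>\<open>join T S B T'\<close>.\<close>

definition attach :: "('v, 'd) pforest \<Rightarrow> 'v set \<Rightarrow> 'v set set" where
  "attach T S = (if S = {} then {roots T} else insert {} {B \<in> blocks T. \<forall>v\<in>B. parents T v = S})"

text \<open>The parent sets that the members of a block can have: empty for roots, a single vertex
  otherwise.\<close>

definition attachable :: "('v, 'd) pforest \<Rightarrow> 'v set \<Rightarrow> bool" where
  "attachable T S \<longleftrightarrow> S = {} \<or> (\<exists>s\<in>verts T. S = {s})"

text \<open>The tree condition puts all roots into one block, and this block contains nothing else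
  because its members share the empty parent set. The case \<open>{}\<close> is the empty
  forest.\<close>

lemma partitioned_tree_roots:
  assumes "partitioned_tree T"
  shows "roots T \<in> insert {} (blocks T)"
proof (cases "roots T = {}")
  case False
  note P = partitioned_forestD[OF partitioned_treeD[OF assms]]
  from False obtain r where r: "r \<in> roots T" by blast
  then obtain B where B: "B \<in> blocks T" "r \<in> B"
    using P(4) by (auto simp: roots_def partition_on_def)
  have "roots T \<subseteq> B" using assms r B by (auto simp: partitioned_tree_def)
  moreover have "B \<subseteq> roots T"
  proof
    fix v assume "v \<in> B"
    then show "v \<in> roots T" using P(6)[OF B(1) B(2), of v] P(7)[OF B(1)] r by (auto simp: roots_def)
  qed
  ultimately show ?thesis using B(1) by auto
qed simp

text \<open>This lets merging and grafting be treated alike: the root block is the block whose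
  members have parent set \<open>S = {}\<close>.\<close>

lemma attachD:
  assumes "partitioned_tree T" "B \<in> attach T S"
  shows "B \<in> insert {} (blocks T)" "\<And>v. v \<in> B \<Longrightarrow> parents T v = S"
  using assms partitioned_tree_roots[OF assms(1)]
  by (auto simp: attach_def roots_def split: if_splits)

text \<open>The edges are well-founded, being finite and acyclic, so a nonempty vertex set has a
  minimal element, which is a root. Such a root later serves as a marker for the block that absorbs
  the roots of a nonempty \<open>T'\<close>.\<close>

lemma roots_empty_iff:
  assumes "partitioned_forest T"
  shows "roots T = {} \<longleftrightarrow> verts T = {}"
proof
  note P = partitioned_forestD[OF assms]
  assume r: "roots T = {}"
  have "wf (edges T)" using P(1,2,3) by (auto intro!: finite_acyclic_wf dest: finite_subset)
  show "verts T = {}"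
  proof (rule ccontr)
    assume "verts T \<noteq> {}"
    from wfE_min'[OF \<open>wf (edges T)\<close> this] obtain z
      where z: "z \<in> verts T" "\<And>y. (y, z) \<in> edges T \<Longrightarrow> y \<notin> verts T" by blast
    then have "z \<in> roots T" using P(2) by (auto simp: roots_def parents_def)
    with r show False by simp
  qed
next
  show "verts T = {} \<Longrightarrow> roots T = {}" by (simp add: roots_def)
qed

text \<open>Both sets may come from optional blocks, hence \<open>insert {}\<close>; the common
  element rules out the empty one.\<close>

lemma partition_block_eq:
  "partition_on V P \<Longrightarrow> Y \<in> insert {} P \<Longrightarrow> X \<in> insert {} P \<Longrightarrow> x \<in> X \<Longrightarrow> x \<in> Y \<Longrightarrow> X = Y"
  by (auto simp: partition_on_def disjoint_def)

lemma glue_eq_None: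
  "partition_on V I \<Longrightarrow> C \<in> insert {} J \<Longrightarrow> partition_on W J \<Longrightarrow>
    glue I {} J C = (`) Inl ` I \<union> (`) Inr ` J"
  by (auto simp: glue_def partition_on_def Plus_def)

lemma merge_roots_eq: "merge_roots T T' = join T {} (roots T) T'"
  by (simp add: merge_roots_def join_def glue_def)

lemma graft_eq:
  assumes "partitioned_tree T" "partitioned_tree T'" "b \<in> insert None (Some ` Bl T s)"
  shows "graft T s b T' = join T {s} (case b of None \<Rightarrow> {} | Some B \<Rightarrow> B) T'"
proof -
  note P = partitioned_forestD[OF partitioned_treeD[OF assms(1)]]
    partitioned_forestD[OF partitioned_treeD[OF assms(2)]]
  have "{(Inl s, Inr r) |r. r \<in> roots T'} = Inl ` {s} \<times> Inr ` roots T'" by auto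
  moreover have "glue (blocks T) {} (blocks T') (roots T') = (`) Inl ` blocks T \<union> (`) Inr ` blocks T'"
    by (rule glue_eq_None[OF P(4) partitioned_tree_roots[OF assms(2)] P(12)])
  \<comment> \<open>Since \<open>B\<close> is nonempty, the removal of the empty set in
    \<open>glue\<close> has no effect here, even when \<open>T'\<close> has no root.\<close>
  moreover have "B \<noteq> {}" if "b = Some B" for B
    using that assms(3) P(8) by (auto simp: Bl_def)
  ultimately show ?thesis
    by (auto simp: graft_def join_def glue_def split: option.split)
qed

lemma attach_singleton:
  assumes "partitioned_forest T"
  shows "attach T {s} = insert {} (Bl T s)"
proof -
  have "(s, v) \<in> edges T \<longleftrightarrow> parents T v = {s}" for v
    using partitioned_forestD(5)[OF assms, of s v] by (auto simp: parents_def)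
  then show ?thesis by (auto simp: attach_def Bl_def)
qed

text \<open>Blocks are nonempty, so \<open>{}\<close> is free to encode the choice
  \<open>None\<close> and the reindexing is injective.\<close>

lemma sum_graft_attach:
  assumes "partitioned_tree T" "partitioned_tree T'"
  shows "(\<Sum>b\<in>insert None (Some ` Bl T s). F (graft T s b T')) =
    (\<Sum>B\<in>attach T {s}. F (join T {s} B T'))"
proof -
  let ?h = "\<lambda>b. case b of None \<Rightarrow> {} | Some B \<Rightarrow> B"
  note P = partitioned_forestD[OF partitioned_treeD[OF assms(1)]]
  have "bij_betw ?h (insert None (Some ` Bl T s)) (attach T {s})"
    unfolding attach_singleton[OF partitioned_treeD[OF assms(1)]] bij_betw_def
    using P(8) by (auto simp: inj_on_def Bl_def image_iff split: option.split)
  from sum.reindex_bij_betw[OF this, of "\<lambda>B. F (join T {s} B T')"] show ?thesis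
    using graft_eq[OF assms, of _ s] sum.cong[OF refl,
        of "insert None (Some ` Bl T s)" "\<lambda>b. F (graft T s b T')" "\<lambda>b. F (join T {s} (?h b) T')"]
    by simp
qed

lemma partition_on_glue:
  assumes "partition_on V I" "partition_on W J" "B \<in> insert {} I" "C \<in> insert {} J"
  shows "partition_on (V <+> W) (glue I B J C)"
proof (rule partition_onI)
  have "\<Union>I = V" "\<Union>J = W" "{} \<notin> I" "{} \<notin> J" using assms by (auto simp: partition_on_def)
  then show "{} \<notin> glue I B J C" "\<Union>(glue I B J C) = V <+> W"
    using assms(3,4) by (auto simp: glue_def Plus_def)
  fix p q assume pq: "p \<in> glue I B J C" "q \<in> glue I B J C" "p \<noteq> q"
  \<comment> \<open>A glued block is determined by any one of its elements: it is the fused block if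
    the element comes from \<open>B\<close> or \<open>C\<close>, and otherwise the image of the old
    block of that element. \<open>L\<close> and \<open>R\<close> say this for the two sides.\<close>
  have L: "v \<in> B \<and> p = B <+> C \<or> v \<notin> B \<and> (\<exists>X\<in>I. v \<in> X \<and> p = Inl ` X)"
    if "p \<in> glue I B J C" "Inl v \<in> p" for p v
    using that partition_block_eq[OF assms(1,3), of _ v] by (auto simp: glue_def)
  have R: "w \<in> C \<and> p = B <+> C \<or> w \<notin> C \<and> (\<exists>X\<in>J. w \<in> X \<and> p = Inr ` X)"
    if "p \<in> glue I B J C" "Inr w \<in> p" for p w
    using that partition_block_eq[OF assms(2,4), of _ w] by (auto simp: glue_def)
  have "p = q" if x: "x \<in> p" "x \<in> q" for x
  proof (cases x)
    case (Inl v)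
    with L[of p v] L[of q v] pq(1,2) x show ?thesis
      using partition_block_eq[OF assms(1), of _ _ v] by blast
  next
    case (Inr w)
    with R[of p w] R[of q w] pq(1,2) x show ?thesis
      using partition_block_eq[OF assms(2), of _ _ w] by blast
  qed
  then show "disjnt p q" using pq(3) by (auto simp: disjnt_def)
qed

lemma parents_join:
  assumes "partitioned_forest T'"
  shows "parents (join T S B T') (Inl v) = Inl ` parents T v"
    "parents (join T S B T') (Inr w) =
      (if w \<in> roots T' then Inl ` S else Inr ` parents T' w)"
proof -
  have "w \<in> verts T'" if "(s, w) \<in> edges T'" for s
    using that partitioned_forestD(2)[OF assms] by auto
  then show "parents (join T S B T') (Inr w) =
      (if w \<in> roots T' then Inl ` S else Inr ` parents T' w)"
    by (auto simp: parents_def join_def roots_def)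
qed (auto simp: parents_def join_def)

lemma roots_join:
  assumes "partitioned_forest T'"
  shows "roots (join T S B T') = (if S = {} then roots T <+> roots T' else Inl ` roots T)"
proof -
  have "Inl v \<in> roots (join T S B T') \<longleftrightarrow> v \<in> roots T" for v
    by (auto simp: roots_def[of T] roots_def[of "join T S B T'"] parents_join[OF assms])
  moreover have "Inr w \<in> roots (join T S B T') \<longleftrightarrow> S = {} \<and> w \<in> roots T'" for w
    unfolding roots_def[of "join T S B T'"]
    by (auto simp: parents_join[OF assms] roots_def[of T'])
  ultimately have "x \<in> roots (join T S B T') \<longleftrightarrow>
      x \<in> (if S = {} then roots T <+> roots T' else Inl ` roots T)" for x
    by (cases x) (simp_all add: Plus_def image_iff)
  then show ?thesis by blast
qed

lemma partitioned_forest_join: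
  assumes T: "partitioned_forest T" and T': "partitioned_forest T'"
    and S: "attachable T S" and B: "B \<in> insert {} (blocks T)" "\<And>v. v \<in> B \<Longrightarrow> parents T v = S"
    and R: "roots T' \<in> insert {} (blocks T')"
  shows "partitioned_forest (join T S B T')"
proof -
  note P = partitioned_forestD[OF T] and P' = partitioned_forestD[OF T']
  have rsub: "roots T' \<subseteq> verts T'" by (auto simp: roots_def)
  have Ssub: "S \<subseteq> verts T" using S by (auto simp: attachable_def)
  have "wf (edges T)" "wf (edges T')"
    using P(1,2,3) P'(1,2,3) by (auto intro!: finite_acyclic_wf dest: finite_subset)
  then have w: "wf (map_prod Inl Inl ` edges T :: (('a + 'c) \<times> _) set)"
    "wf (map_prod Inr Inr ` edges T' :: (('a + 'c) \<times> _) set)"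
    by (auto intro: wf_map_prod_image)
  \<comment> \<open>The new edges all go from left to right, so ranking the left side by 0 and the
    right side by 1 shows that they are well-founded. In the two unions that follow, the first
    relation has its domain on the left and the second its range on the right, as
    \<open>wf_Un\<close> demands.\<close>
  have "wf (Inl ` S \<times> Inr ` roots T' :: (('a + 'c) \<times> ('a + 'c)) set)"
    by (rule wf_subset[of "inv_image {(0::nat, 1)} (case_sum (\<lambda>_. 0) (\<lambda>_. 1))"])
      (auto intro!: wf_inv_image)
  from wf_Un[OF this w(2)] have "wf (Inl ` S \<times> Inr ` roots T' \<union> map_prod Inr Inr ` edges T')" by auto
  from wf_Un[OF w(1) this]
  have "wf (map_prod Inl Inl ` edges T \<union> (Inl ` S \<times> Inr ` roots T' \<union> map_prod Inr Inr ` edges T'))"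
    by auto
  then have "acyclic (edges (join T S B T'))"
    by (intro wf_acyclic) (simp add: join_def Un_ac)
  moreover have "edges (join T S B T') \<subseteq> verts (join T S B T') \<times> verts (join T S B T')"
    using P(2) P'(2) rsub Ssub by (auto simp: join_def)
  moreover have "s = s'" if "s \<in> parents (join T S B T') x" "s' \<in> parents (join T S B T') x" for x s s'
    using that S
    by (cases x) (auto simp: parents_join[OF T'] attachable_def split: if_splits dest: P(5) P'(5))
  moreover have "parents (join T S B T') x = parents (join T S B T') y"
    if X: "X \<in> blocks (join T S B T')" "x \<in> X" "y \<in> X" for X x y
  proof -
    consider Y where "Y \<in> blocks T" "X = Inl ` Y" | Y where "Y \<in> blocks T'" "X = Inr ` Y" "Y \<noteq> roots T'"
      | "X = B <+> roots T'"
      using X(1) by (auto simp: glue_def)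
    then show ?thesis
    proof cases
      case (1 Y)
      with X(2,3) obtain v w where "x = Inl v" "y = Inl w" "v \<in> Y" "w \<in> Y" by auto
      then show ?thesis using P(6)[OF 1(1), of v w] by (simp add: parents_join[OF T'])
    next
      case (2 Y)
      \<comment> \<open>A block of \<open>T'\<close> other than the root block contains no root, so
        the new edges leave the parents of its members unchanged.\<close>
      have "w \<notin> roots T'" if "w \<in> Y" for w
        using that 2 partition_block_eq[OF P'(4) R, of Y w] by auto
      moreover from 2 X(2,3) obtain v w where "x = Inr v" "y = Inr w" "v \<in> Y" "w \<in> Y" by auto
      ultimately show ?thesis using P'(6)[OF 2(1), of v w] by (simp add: parents_join[OF T'])
    next
      case 3
      have "parents (join T S B T') z = Inl ` S" if "z \<in> B <+> roots T'" for z
        using that B(2) by (auto simp: parents_join[OF T'])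
      with 3 X(2,3) show ?thesis by simp
    qed
  qed
  moreover have "finite (verts (join T S B T'))"
    "partition_on (verts (join T S B T')) (blocks (join T S B T'))"
    using P(1) P'(1) partition_on_glue[OF P(4) P'(4) B(1) R] by simp_all
  ultimately show ?thesis
    unfolding partitioned_forest_def rooted_forest_def by blast
qed

lemma partitioned_tree_join:
  assumes T: "partitioned_tree T" and T': "partitioned_tree T'"
    and S: "attachable T S" and B: "B \<in> attach T S"
  shows "partitioned_tree (join T S B T')"
  unfolding partitioned_tree_def
proof (intro conjI ballI impI)
  note P = partitioned_forestD[OF partitioned_treeD[OF T]]
  show "partitioned_forest (join T S B T')"
    using attachD[OF T B] by (intro partitioned_forest_join partitioned_treeD T T' S
      partitioned_tree_roots)
  fix X u v assume X: "X \<in> blocks (join T S B T')" and u: "u \<in> roots (join T S B T')"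
    and v: "v \<in> roots (join T S B T')" and uX: "u \<in> X"
  note r = roots_join[OF partitioned_treeD[OF T'], of T S B]
  show "v \<in> X"
  proof (cases "S = {}")
    case True
    have "roots T <+> roots T' \<in> insert {} (glue (blocks T) B (blocks T') (roots T'))"
      using B True by (auto simp: attach_def glue_def)
    moreover have "partition_on (verts T <+> verts T') (glue (blocks T) B (blocks T') (roots T'))"
      using \<open>partitioned_forest (join T S B T')\<close> by (auto dest: partitioned_forestD(4))
    ultimately have "X = roots T <+> roots T'"
      by (intro partition_block_eq[where x = u]) (use X u uX r True in auto)
    then show ?thesis using v r True by simp
  next
    case False
    then obtain u' v' where uv: "u = Inl u'" "v = Inl v'" "u' \<in> roots T" "v' \<in> roots T"
      using u v r by auto
    \<comment> \<open>Members of \<open>B\<close> have the nonempty parent set \<open>S\<close>, so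
      the root block of \<open>T\<close> is not the fused one and survives unchanged.\<close>
    have "u' \<notin> B" using attachD(2)[OF T B] uv(3) False by (auto simp: roots_def)
    with X uX uv obtain Y where Y: "Y \<in> blocks T" "X = Inl ` Y" "u' \<in> Y" by (auto simp: glue_def)
    with T uv have "v' \<in> Y" by (auto simp: partitioned_tree_def)
    with Y uv show ?thesis by simp
  qed
qed

section \<open>Coarsenings\<close>

text \<open>The index set for \<open>Psi\<close>: partitions of the fixed vertex set rather than
  isomorphism classes, so that isomorphic terms are counted with multiplicity.\<close>

definition coarsenings :: "('v, 'd) pforest \<Rightarrow> 'v set set set" where
  "coarsenings T = {J. refines (verts T) (blocks T) J \<and>
     (\<forall>B\<in>J. \<forall>u\<in>B. \<forall>v\<in>B. parents T u = parents T v)}"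

lemma coarseningsD:
  assumes "J \<in> coarsenings T"
  shows "partition_on (verts T) J" "\<And>X. X \<in> blocks T \<Longrightarrow> \<exists>Y\<in>J. X \<subseteq> Y"
    "\<And>B u v. B \<in> J \<Longrightarrow> u \<in> B \<Longrightarrow> v \<in> B \<Longrightarrow> parents T u = parents T v"
  using assms unfolding coarsenings_def refines_def mem_Collect_eq by blast+

lemma finite_coarsenings: "partitioned_forest T \<Longrightarrow> finite (coarsenings T)"
  by (rule finite_subset[of _ "Pow (Pow (verts T))"])
    (auto simp: coarsenings_def refines_def partition_on_def dest: partitioned_forestD(1))

lemma parents_blocks [simp]: "parents (T\<lparr>blocks := J\<rparr>) = parents T"
  by (simp add: parents_def fun_eq_iff)

lemma roots_blocks [simp]: "roots (T\<lparr>blocks := J\<rparr>) = roots T"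
  by (simp add: roots_def)

lemma rooted_forest_blocks [simp]: "rooted_forest (T\<lparr>blocks := J\<rparr>) = rooted_forest T"
  by (simp add: rooted_forest_def)

text \<open>The forest is unchanged, and the roots stay together because they form one block of
  \<open>T\<close>, which lies inside one block of \<open>J\<close>.\<close>

lemma partitioned_tree_blocks:
  assumes T: "partitioned_tree T" and J: "J \<in> coarsenings T"
  shows "partitioned_tree (T\<lparr>blocks := J\<rparr>)"
  unfolding partitioned_tree_def
proof (intro conjI ballI impI)
  show "partitioned_forest (T\<lparr>blocks := J\<rparr>)"
    unfolding partitioned_forest_def
  proof (intro conjI ballI)
    show "rooted_forest (T\<lparr>blocks := J\<rparr>)"
      using partitioned_treeD[OF T] by (simp add: partitioned_forest_def)
  next
    fix B u v assume "B \<in> blocks (T\<lparr>blocks := J\<rparr>)" "u \<in> B" "v \<in> B"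
    then show "parents (T\<lparr>blocks := J\<rparr>) u = parents (T\<lparr>blocks := J\<rparr>) v"
      using coarseningsD(3)[OF J, of B u v] by simp
  qed (use coarseningsD(1)[OF J] in simp)
  fix X u v assume *: "X \<in> blocks (T\<lparr>blocks := J\<rparr>)" "u \<in> roots (T\<lparr>blocks := J\<rparr>)"
    "v \<in> roots (T\<lparr>blocks := J\<rparr>)" "u \<in> X"
  then have "roots T \<in> blocks T" using partitioned_tree_roots[OF T] by auto
  from coarseningsD(2)[OF J this] obtain Y where "Y \<in> J" "roots T \<subseteq> Y" by blast
  with * partition_block_eq[OF coarseningsD(1)[OF J], of Y X u] show "v \<in> X" by auto
qed

text \<open>\<open>coarser\<close> fixes every field except \<open>blocks\<close>, and
  \<open>deco\<close> even outside the vertices, so a term of \<open>Psi\<close> is determined by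
  its partition.\<close>

lemma coarser_eq_image:
  assumes T: "partitioned_tree T"
  shows "{T'. partitioned_tree T' \<and> coarser T' T} = (\<lambda>J. T\<lparr>blocks := J\<rparr>) ` coarsenings T"
proof (intro equalityI subsetI)
  fix T' assume "T' \<in> {T'. partitioned_tree T' \<and> coarser T' T}"
  then have T': "partitioned_tree T'" "verts T' = verts T" "edges T' = edges T" "deco T' = deco T"
    "refines (verts T) (blocks T) (blocks T')" by (auto simp: coarser_def)
  then have "T' = T\<lparr>blocks := blocks T'\<rparr>" by simp
  moreover have "parents T' = parents T" using T'(3) by (simp add: parents_def fun_eq_iff)
  then have "blocks T' \<in> coarsenings T"
    using T'(5) partitioned_forestD(6)[OF partitioned_treeD[OF T'(1)]]
    unfolding coarsenings_def mem_Collect_eq by metis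
  ultimately show "T' \<in> (\<lambda>J. T\<lparr>blocks := J\<rparr>) ` coarsenings T" by blast
next
  fix T' assume "T' \<in> (\<lambda>J. T\<lparr>blocks := J\<rparr>) ` coarsenings T"
  then show "T' \<in> {T'. partitioned_tree T' \<and> coarser T' T}"
    using partitioned_tree_blocks[OF T] by (auto simp: coarser_def coarsenings_def)
qed

lemma sum_coarser:
  assumes "partitioned_tree T"
  shows "(\<Sum>T' | partitioned_tree T' \<and> coarser T' T. F T') = (\<Sum>J\<in>coarsenings T. F (T\<lparr>blocks := J\<rparr>))"
proof -
  have "inj_on (\<lambda>J. T\<lparr>blocks := J\<rparr>) (coarsenings T)"
    by (rule inj_on_inverseI[of _ blocks]) simp
  then show ?thesis unfolding coarser_eq_image[OF assms] by (simp add: sum.reindex)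
qed

text \<open>Restriction to one side undoes gluing; the blocks living on the other side restrict to
  the empty set, whence its removal. This gives the injectivity of \<open>glue\<close> in the two
  partitions.\<close>

lemma vimage_glue:
  assumes "partition_on V I" "partition_on W J" "B \<in> insert {} I" "C \<in> insert {} J"
  shows "(-`) Inl ` glue I B J C - {{}} = I" "(-`) Inr ` glue I B J C - {{}} = J"
proof -
  have ne: "{} \<notin> I" "{} \<notin> J" using assms(1,2) by (auto simp: partition_on_def)
  have [simp]: "Inl -` Inl ` X = X" "Inr -` Inr ` Y = Y" "Inl -` Inr ` Y = {}" "Inr -` Inl ` X = {}"
    "Inl -` (X <+> Y) = X" "Inr -` (X <+> Y) = Y" for X :: "'a set" and Y :: "'b set"
    by auto
  show "(-`) Inl ` glue I B J C - {{}} = I"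
  proof (intro equalityI subsetI)
    fix X assume X: "X \<in> I"
    show "X \<in> (-`) Inl ` glue I B J C - {{}}"
    proof (cases "X = B")
      case True
      then have "B <+> C \<in> glue I B J C" using X ne by (auto simp: glue_def)
      then show ?thesis using True X ne by (auto simp: image_iff intro!: bexI[of _ "B <+> C"])
    next
      case False
      then have "Inl ` X \<in> glue I B J C" using X by (auto simp: glue_def)
      then show ?thesis using X ne by (auto simp: image_iff intro!: bexI[of _ "Inl ` X"])
    qed
  qed (use assms(3) in \<open>auto simp: glue_def\<close>)
  show "(-`) Inr ` glue I B J C - {{}} = J"
  proof (intro equalityI subsetI)
    fix Y assume Y: "Y \<in> J"
    show "Y \<in> (-`) Inr ` glue I B J C - {{}}"
    proof (cases "Y = C")
      case True
      then have "B <+> C \<in> glue I B J C" using Y ne by (auto simp: glue_def)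
      then show ?thesis using True Y ne by (auto simp: image_iff intro!: bexI[of _ "B <+> C"])
    next
      case False
      then have "Inr ` Y \<in> glue I B J C" using Y by (auto simp: glue_def)
      then show ?thesis using Y ne by (auto simp: image_iff intro!: bexI[of _ "Inr ` Y"])
    qed
  qed (use assms(4) in \<open>auto simp: glue_def\<close>)
qed

text \<open>The converse of \<open>vimage_glue\<close>: restricting loses nothing as long as at most
  the block \<open>M\<close> meets both sides, because every other block is already a block of one
  restriction. \<open>M = {}\<close> means that no block needs to be fused.\<close>

lemma glue_vimage:
  assumes K: "partition_on A K" and M: "M \<in> insert {} K"
    and sides: "\<And>X. X \<in> K \<Longrightarrow> X \<noteq> M \<Longrightarrow> X \<subseteq> range Inl \<or> X \<subseteq> range Inr"
  shows "K = glue ((-`) Inl ` K - {{}}) (Inl -` M) ((-`) Inr ` K - {{}}) (Inr -` M)" (is "_ = ?G")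
proof (intro equalityI subsetI)
  have M_eq: "M = Inl -` M <+> Inr -` M"
    by (auto simp: Plus_def image_iff) (metis sum.exhaust vimageI)
  have ne: "X \<noteq> {}" if "X \<in> K" for X using K that by (auto simp: partition_on_def)
  {
    fix X assume X: "X \<in> K"
    consider "X = M" | Y where "X \<noteq> M" "X = Inl ` Y" | Y where "X \<noteq> M" "X = Inr ` Y"
      using sides[OF X] by (metis subset_imageE)
    then show "X \<in> ?G"
    proof cases
      case 1
      then show ?thesis using ne[OF X] unfolding glue_def M_eq[symmetric] by blast
    next
      case (2 Y)
      then have Y: "Inl -` X = Y" by auto
      have "Y \<noteq> {}" using ne[OF X] 2 by auto
      then obtain y where "y \<in> Y" by blast
      have "Y \<noteq> Inl -` M"
      proof
        assume "Y = Inl -` M"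
        with \<open>y \<in> Y\<close> have "Inl y \<in> M" by simp
        moreover have "Inl y \<in> X" using \<open>y \<in> Y\<close> Y by auto
        ultimately have "X = M" using partition_block_eq[OF K M, of X] X by simp
        with 2 show False by simp
      qed
      with \<open>Y \<noteq> {}\<close> imageI[OF X, of "(-`) Inl"] have "Y \<in> (-`) Inl ` K - {{}} - {Inl -` M}"
        unfolding Y by simp
      then show ?thesis unfolding glue_def \<open>X = Inl ` Y\<close> by (intro UnI1[OF UnI1] imageI)
    next
      case (3 Y)
      then have Y: "Inr -` X = Y" by auto
      have "Y \<noteq> {}" using ne[OF X] 3 by auto
      then obtain y where "y \<in> Y" by blast
      have "Y \<noteq> Inr -` M"
      proof
        assume "Y = Inr -` M"
        with \<open>y \<in> Y\<close> have "Inr y \<in> M" by simp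
        moreover have "Inr y \<in> X" using \<open>y \<in> Y\<close> Y by auto
        ultimately have "X = M" using partition_block_eq[OF K M, of X] X by simp
        with 3 show False by simp
      qed
      with \<open>Y \<noteq> {}\<close> imageI[OF X, of "(-`) Inr"] have "Y \<in> (-`) Inr ` K - {{}} - {Inr -` M}"
        unfolding Y by simp
      then show ?thesis unfolding glue_def \<open>X = Inr ` Y\<close> by (intro UnI1[OF UnI2] imageI)
    qed
  }
  fix X assume "X \<in> ?G"
  then consider "X \<in> (`) Inl ` ((-`) Inl ` K - {{}} - {Inl -` M})"
    | "X \<in> (`) Inr ` ((-`) Inr ` K - {{}} - {Inr -` M})" | "X \<in> {M} - {{}}"
    unfolding glue_def M_eq[symmetric] by (elim UnE)
  then show "X \<in> K"
  proof cases
    case 1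
    then obtain Y where Y: "Y \<in> K" "X = Inl ` Inl -` Y" "Inl -` Y \<noteq> {}" "Y \<noteq> M" by auto
    then have "Inl ` Inl -` Y = Y" using sides[of Y] by auto
    with Y show ?thesis by simp
  next
    case 2
    then obtain Y where Y: "Y \<in> K" "X = Inr ` Inr -` Y" "Inr -` Y \<noteq> {}" "Y \<noteq> M" by auto
    then have "Inr ` Inr -` Y = Y" using sides[of Y] by auto
    with Y show ?thesis by simp
  qed (use M in auto)
qed

lemma subset_glue_left:
  assumes "Z \<in> I" "Z \<noteq> {}"
  shows "\<exists>Y\<in>glue I B J C. Inl ` Z \<subseteq> Y"
proof (cases "Z = B")
  case True
  then have "B <+> C \<in> glue I B J C" using assms by (auto simp: glue_def)
  moreover have "Inl ` Z \<subseteq> B <+> C" using True by auto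
  ultimately show ?thesis by blast
next
  case False
  then have "Inl ` Z \<in> glue I B J C" using assms by (simp add: glue_def)
  then show ?thesis by blast
qed

lemma subset_glue_right:
  assumes "Z \<in> J" "Z \<noteq> {}"
  shows "\<exists>Y\<in>glue I B J C. Inr ` Z \<subseteq> Y"
proof (cases "Z = C")
  case True
  then have "B <+> C \<in> glue I B J C" using assms by (auto simp: glue_def)
  moreover have "Inr ` Z \<subseteq> B <+> C" using True by auto
  ultimately show ?thesis by blast
next
  case False
  then have "Inr ` Z \<in> glue I B J C" using assms by (simp add: glue_def)
  then show ?thesis by blast
qed

text \<open>The glued partition is the set of blocks of the join of the two coarsened trees, so
  \<open>partitioned_tree_join\<close> supplies the partition and parent conditions; only the
  refinement is checked by hand.\<close>

lemma coarsenings_glue: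
  assumes T: "partitioned_tree T" and T': "partitioned_tree T'" and S: "attachable T S"
    and J: "J \<in> coarsenings T" and J': "J' \<in> coarsenings T'" and B: "B \<in> attach (T\<lparr>blocks := J\<rparr>) S"
  shows "glue J B J' (roots T') \<in> coarsenings (join T S (if S = {} then roots T else {}) T')"
    (is "?K \<in> coarsenings ?U")
proof -
  \<comment> \<open>The smallest admissible choice of fused block: merging always fuses the roots,
    while unmerged grafting fuses nothing. Every other choice contains it.\<close>
  let ?B0 = "if S = {} then roots T else {}"
  have eq: "join (T\<lparr>blocks := J\<rparr>) S B (T'\<lparr>blocks := J'\<rparr>) = ?U\<lparr>blocks := ?K\<rparr>"
    by (simp add: join_def)
  have "attachable (T\<lparr>blocks := J\<rparr>) S" using S by (simp add: attachable_def)
  from partitioned_treeD[OF partitioned_tree_join[OF partitioned_tree_blocks[OF T J]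
        partitioned_tree_blocks[OF T' J'] this B]]
  have U: "partitioned_forest (?U\<lparr>blocks := ?K\<rparr>)" unfolding eq .
  have B0: "?B0 \<in> attach T S" by (simp add: attach_def)
  have "partition_on (verts ?U) (blocks ?U)"
    using partitioned_forestD(4)[OF partitioned_treeD[OF partitioned_tree_join[OF T T' S B0]]] .
  moreover have "partition_on (verts ?U) ?K" using partitioned_forestD(4)[OF U] by simp
  moreover have "\<exists>Y\<in>?K. X \<subseteq> Y" if X: "X \<in> blocks ?U" for X
  proof -
    have L: "\<exists>Y\<in>?K. Inl ` Z \<subseteq> Y" if Z: "Z \<in> blocks T" for Z
    proof -
      obtain W where W: "W \<in> J" "Z \<subseteq> W" using coarseningsD(2)[OF J Z] by blast
      moreover from this have "W \<noteq> {}" using coarseningsD(1)[OF J] by (auto simp: partition_on_def)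
      ultimately show ?thesis using subset_glue_left[of W J B J' "roots T'"] by (meson image_mono order_trans)
    qed
    have R: "\<exists>Y\<in>?K. Inr ` Z \<subseteq> Y" if Z: "Z \<in> blocks T'" for Z
    proof -
      obtain W where W: "W \<in> J'" "Z \<subseteq> W" using coarseningsD(2)[OF J' Z] by blast
      moreover from this have "W \<noteq> {}" using coarseningsD(1)[OF J'] by (auto simp: partition_on_def)
      ultimately show ?thesis using subset_glue_right[of W J' J B "roots T'"] by (meson image_mono order_trans)
    qed
    have M: "\<exists>Y\<in>?K. ?B0 <+> roots T' \<subseteq> Y" if "?B0 <+> roots T' \<noteq> {}"
    proof -
      have "?B0 \<subseteq> B" using B by (auto simp: attach_def)
      then have "?B0 <+> roots T' \<subseteq> B <+> roots T'" by auto
      moreover from this have "B <+> roots T' \<in> ?K" using that unfolding glue_def by blast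
      ultimately show ?thesis by blast
    qed
    from X consider Z where "X = Inl ` Z" "Z \<in> blocks T" | Z where "X = Inr ` Z" "Z \<in> blocks T'"
      | "X = ?B0 <+> roots T'" "X \<noteq> {}"
      unfolding join_simps glue_def by (elim UnE imageE DiffE) blast+
    then show ?thesis
    proof cases
      case (1 Z)
      show ?thesis unfolding 1(1) by (rule L[OF 1(2)])
    next
      case (2 Z)
      show ?thesis unfolding 2(1) by (rule R[OF 2(2)])
    next
      case 3
      show ?thesis unfolding 3(1) by (rule M) (use 3 in simp)
    qed
  qed
  moreover have "parents ?U u = parents ?U v" if "X \<in> ?K" "u \<in> X" "v \<in> X" for X u v
    using partitioned_forestD(6)[OF U, of X u v] that by simp
  ultimately show ?thesis
    unfolding coarsenings_def refines_def mem_Collect_eq by blast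
qed

text \<open>The two partitions are the restrictions of \<open>K\<close>, and \<open>B\<close> is the
  left part of the block containing the roots of \<open>T'\<close>. In the grafting case this block
  can be found only if \<open>T'\<close> has a root, which is the purpose of the hypothesis on
  \<open>verts T'\<close>.\<close>

lemma coarsenings_join_split:
  assumes T: "partitioned_tree T" and T': "partitioned_tree T'" and S: "attachable T S"
    and ne: "S = {} \<or> verts T' \<noteq> {}"
    and K: "K \<in> coarsenings (join T S (if S = {} then roots T else {}) T')"
  shows "\<exists>J\<in>coarsenings T. \<exists>J'\<in>coarsenings T'. \<exists>B\<in>attach (T\<lparr>blocks := J\<rparr>) S.
    K = glue J B J' (roots T')"
proof -
  let ?B0 = "if S = {} then roots T else {}"
  let ?U = "join T S ?B0 T'"
  let ?J = "(-`) Inl ` K - {{}}" and ?J' = "(-`) Inr ` K - {{}}"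
  note P = partitioned_forestD[OF partitioned_treeD[OF T]]
    and P' = partitioned_forestD[OF partitioned_treeD[OF T']]
  note par = parents_join[OF partitioned_treeD[OF T'], of T S ?B0]
  note C = coarseningsD[OF K]
  \<comment> \<open>A non-root of \<open>T'\<close> keeps a parent on the right, while the parents
    of a vertex of \<open>T\<close> lie on the left. Hence a block of \<open>K\<close> that meets
    both sides meets the right side in roots of \<open>T'\<close> only.\<close>
  have nonroot: "parents T' w \<noteq> {}" if "w \<in> verts T'" "w \<notin> roots T'" for w
    using that by (auto simp: roots_def)
  have vU: "X \<subseteq> verts T <+> verts T'" if "X \<in> K" for X
    using C(1) that by (auto simp: partition_on_def)
  have parR: "parents T' u = parents T' w" "u \<in> roots T' \<longleftrightarrow> w \<in> roots T'"
    if "X \<in> K" "Inr u \<in> X" "Inr w \<in> X" for X u w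
  proof -
    have "u \<in> verts T'" "w \<in> verts T'" using vU[OF that(1)] that(2,3) by auto
    then have "u \<in> roots T' \<longleftrightarrow> w \<in> roots T'"
      using C(3)[OF that] nonroot by (auto simp: par split: if_splits)
    then show "u \<in> roots T' \<longleftrightarrow> w \<in> roots T'" "parents T' u = parents T' w"
      using C(3)[OF that] by (auto simp: par inj_image_eq_iff roots_def split: if_splits)
  qed
  have parL: "parents T u = parents T w" if "X \<in> K" "Inl u \<in> X" "Inl w \<in> X" for X u w
    using C(3)[OF that] by (simp add: par inj_image_eq_iff)
  have "partition_on (Inl -` (verts T <+> verts T')) ?J"
    using partition_on_vimage[OF C(1), of Inl] by simp
  moreover have "Inl -` (verts T <+> verts T') = verts T" by auto
  ultimately have pJ: "partition_on (verts T) ?J" by simp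
  have "partition_on (Inr -` (verts T <+> verts T')) ?J'"
    using partition_on_vimage[OF C(1), of Inr] by simp
  moreover have "Inr -` (verts T <+> verts T') = verts T'" by auto
  ultimately have pJ': "partition_on (verts T') ?J'" by simp
  have big: "\<exists>Y\<in>blocks ?U. Inl ` Z \<subseteq> Y" if "Z \<in> blocks T" for Z
    using subset_glue_left[OF that] that P(8) by auto
  have big': "\<exists>Y\<in>blocks ?U. Inr ` Z \<subseteq> Y" if "Z \<in> blocks T'" for Z
    using subset_glue_right[OF that] that P'(8) by auto
  have J: "?J \<in> coarsenings T"
  proof -
    have "\<exists>Y\<in>?J. Z \<subseteq> Y" if Z: "Z \<in> blocks T" for Z
    proof -
      obtain X where "X \<in> K" "Inl ` Z \<subseteq> X" using big[OF Z] C(2) by (meson order_trans)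
      moreover have "Z \<noteq> {}" using P(8) Z by auto
      ultimately show ?thesis by (intro bexI[of _ "Inl -` X"]) auto
    qed
    then show ?thesis using P(4) pJ parL unfolding coarsenings_def refines_def by blast
  qed
  have J': "?J' \<in> coarsenings T'"
  proof -
    have "\<exists>Y\<in>?J'. Z \<subseteq> Y" if Z: "Z \<in> blocks T'" for Z
    proof -
      obtain X where "X \<in> K" "Inr ` Z \<subseteq> X" using big'[OF Z] C(2) by (meson order_trans)
      moreover have "Z \<noteq> {}" using P'(8) Z by auto
      ultimately show ?thesis by (intro bexI[of _ "Inr -` X"]) auto
    qed
    then show ?thesis using P'(4) pJ' parR(1) unfolding coarsenings_def refines_def by blast
  qed
  have B0: "?B0 \<in> attach T S" by (simp add: attach_def)
  have U: "partitioned_tree ?U" by (rule partitioned_tree_join[OF T T' S B0])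
  \<comment> \<open>\<open>M\<close> is the only block of \<open>K\<close> that may meet both sides.
    For merging it is the set of all roots; for grafting it is the block around the roots of
    \<open>T'\<close>, whose left part then has parent set \<open>S\<close>, like the roots
    themselves after grafting.\<close>
  obtain M where M: "M \<in> insert {} K" "Inr -` M = roots T'" "Inl -` M \<in> attach (T\<lparr>blocks := ?J\<rparr>) S"
  proof (cases "S = {}")
    case True
    have "roots ?U = roots T <+> roots T'"
      using True by (simp add: roots_join[OF partitioned_treeD[OF T']])
    moreover have "roots ?U \<in> insert {} K"
      using partitioned_tree_roots[OF partitioned_tree_blocks[OF U K]] by simp
    ultimately have M: "roots T <+> roots T' \<in> insert {} K" by simp
    show ?thesis by (rule that[OF M]) (use True in \<open>auto simp: attach_def\<close>)
  next
    case False
    then have "roots T' \<noteq> {}" using ne roots_empty_iff[OF partitioned_treeD[OF T']] by simp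
    moreover from this have "roots T' \<in> blocks T'" using partitioned_tree_roots[OF T'] by auto
    from big'[OF this] obtain M where M: "M \<in> K" "Inr ` roots T' \<subseteq> M"
      using C(2) by (meson order_trans)
    ultimately obtain r where r: "r \<in> roots T'" "Inr r \<in> M" by auto
    have "Inr -` M = roots T'" using M parR(2)[OF M(1) r(2)] r(1) by auto
    moreover have "parents T v = S" if "Inl v \<in> M" for v
      using C(3)[OF M(1) r(2) that] r(1) by (simp add: par inj_image_eq_iff)
    then have "Inl -` M \<in> attach (T\<lparr>blocks := ?J\<rparr>) S"
      using False M(1) by (auto simp: attach_def)
    ultimately show ?thesis using that M(1) by blast
  qed
  have "X \<subseteq> range Inl \<or> X \<subseteq> range Inr" if X: "X \<in> K" "X \<noteq> M" for X
  proof (rule ccontr)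
    assume "\<not> (X \<subseteq> range Inl \<or> X \<subseteq> range Inr)"
    then obtain v w where vw: "Inl v \<in> X" "Inr w \<in> X" by (metis subsetI rangeI sum.exhaust)
    have "w \<notin> roots T'"
      using partition_block_eq[OF C(1) M(1), of X "Inr w"] X vw M(2) by auto
    moreover have "w \<in> verts T'" using vU[OF X(1)] vw by auto
    ultimately show False using C(3)[OF X(1) vw] nonroot[of w] by (auto simp: par)
  qed
  from glue_vimage[OF C(1) M(1) this] have "K = glue ?J (Inl -` M) ?J' (roots T')"
    using M(2) by simp
  with J J' M(3) show ?thesis by blast
qed

text \<open>The combinatorial core: \<open>S = {}\<close> yields compatibility with the dot product,
  and \<open>S = {s}\<close> turns unmerged grafting into grafting with a chosen block. Grafting an
  empty \<open>T'\<close> is excluded because all choices of \<open>B\<close> would then give the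
  same glued partition.\<close>

lemma bij_betw_coarsenings_join:
  assumes T: "partitioned_tree T" and T': "partitioned_tree T'" and S: "attachable T S"
    and ne: "S = {} \<or> verts T' \<noteq> {}"
  shows "bij_betw (\<lambda>(J, J', B). glue J B J' (roots T'))
    (SIGMA J:coarsenings T. coarsenings T' \<times> attach (T\<lparr>blocks := J\<rparr>) S)
    (coarsenings (join T S (if S = {} then roots T else {}) T'))"
  unfolding bij_betw_def
proof
  have facts: "partition_on (verts T) J" "partition_on (verts T') J'" "B \<in> insert {} J"
    "roots T' \<in> insert {} J'"
    if "J \<in> coarsenings T" "J' \<in> coarsenings T'" "B \<in> attach (T\<lparr>blocks := J\<rparr>) S" for J J' B
    using that coarseningsD(1) attachD(1)[OF partitioned_tree_blocks[OF T that(1)] that(3)]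
      partitioned_tree_roots[OF partitioned_tree_blocks[OF T' that(2)]] by auto
  show "inj_on (\<lambda>(J, J', B). glue J B J' (roots T'))
    (SIGMA J:coarsenings T. coarsenings T' \<times> attach (T\<lparr>blocks := J\<rparr>) S)"
  proof (rule inj_onI)
    fix p q
    assume pq: "p \<in> (SIGMA J:coarsenings T. coarsenings T' \<times> attach (T\<lparr>blocks := J\<rparr>) S)"
        "q \<in> (SIGMA J:coarsenings T. coarsenings T' \<times> attach (T\<lparr>blocks := J\<rparr>) S)"
      and "(case p of (J, J', B) \<Rightarrow> glue J B J' (roots T')) = (case q of (J, J', B) \<Rightarrow> glue J B J' (roots T'))"
    moreover obtain J J' B L L' E where p: "p = (J, J', B)" "q = (L, L', E)"
      by (metis prod.exhaust)
    ultimately have J: "J \<in> coarsenings T" "J' \<in> coarsenings T'" "B \<in> attach (T\<lparr>blocks := J\<rparr>) S"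
      and L: "L \<in> coarsenings T" "L' \<in> coarsenings T'" "E \<in> attach (T\<lparr>blocks := L\<rparr>) S"
      and eq: "glue J B J' (roots T') = glue L E L' (roots T')" by auto
    have "J = L" "J' = L'" using vimage_glue[OF facts[OF J]] vimage_glue[OF facts[OF L]] eq by auto
    \<comment> \<open>For merging there is only one choice. For grafting, a root of
      \<open>T'\<close> identifies the fused block in both descriptions, and its left part is the
      chosen block.\<close>
    moreover have "B = E"
    proof (cases "S = {}")
      case False
      then have "roots T' \<noteq> {}" using ne roots_empty_iff[OF partitioned_treeD[OF T']] by simp
      then obtain r where r: "r \<in> roots T'" by blast
      have "B <+> roots T' \<in> glue J B J' (roots T')" "E <+> roots T' \<in> glue L E L' (roots T')"
        using r by (auto simp: glue_def)
      then have "B <+> roots T' = E <+> roots T'"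
        using partition_block_eq[OF partition_on_glue[OF facts[OF J]],
          of "B <+> roots T'" "E <+> roots T'" "Inr r"] r eq by auto
      then have "Inl -` (B <+> roots T') = Inl -` (E <+> roots T')" by simp
      then show ?thesis by auto
    qed (use J(3) L(3) in \<open>simp add: attach_def\<close>)
    ultimately show "p = q" using p by simp
  qed
  show "(\<lambda>(J, J', B). glue J B J' (roots T')) `
      (SIGMA J:coarsenings T. coarsenings T' \<times> attach (T\<lparr>blocks := J\<rparr>) S) =
    coarsenings (join T S (if S = {} then roots T else {}) T')" (is "?f ` ?A = ?C")
  proof (intro equalityI subsetI)
    fix K assume "K \<in> ?f ` ?A"
    then obtain J J' B where "J \<in> coarsenings T" "J' \<in> coarsenings T'"
      "B \<in> attach (T\<lparr>blocks := J\<rparr>) S" and K: "K = glue J B J' (roots T')" by auto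
    then show "K \<in> ?C" unfolding K by (intro coarsenings_glue T T' S)
  next
    fix K assume "K \<in> ?C"
    then obtain J J' B where "J \<in> coarsenings T" "J' \<in> coarsenings T'"
      "B \<in> attach (T\<lparr>blocks := J\<rparr>) S" and K: "K = glue J B J' (roots T')"
      using coarsenings_join_split[OF T T' S ne] by blast
    then show "K \<in> ?f ` ?A" by (intro image_eqI[of _ _ "(J, J', B)"]) simp_all
  qed
qed

lemma finite_attach: "partitioned_forest T \<Longrightarrow> finite (attach T S)"
  using partitioned_forestD(1,7)[of T]
  by (auto simp: attach_def intro!: finite_subset[of "{B \<in> blocks T. \<forall>v\<in>B. parents T v = S}" "Pow (verts T)"])

lemma sum_coarsenings_join:
  assumes T: "partitioned_tree T" and T': "partitioned_tree T'" and S: "attachable T S"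
    and ne: "S = {} \<or> verts T' \<noteq> {}"
  defines "U \<equiv> join T S (if S = {} then roots T else {}) T'"
  shows "(\<Sum>K\<in>coarsenings U. F (U\<lparr>blocks := K\<rparr>)) =
    (\<Sum>J\<in>coarsenings T. \<Sum>J'\<in>coarsenings T'. \<Sum>B\<in>attach (T\<lparr>blocks := J\<rparr>) S.
      F (join (T\<lparr>blocks := J\<rparr>) S B (T'\<lparr>blocks := J'\<rparr>)))"
proof -
  have eq: "U\<lparr>blocks := glue J B J' (roots T')\<rparr> = join (T\<lparr>blocks := J\<rparr>) S B (T'\<lparr>blocks := J'\<rparr>)" for J B J'
    by (simp add: U_def join_def)
  note fin = finite_coarsenings[OF partitioned_treeD[OF T]] finite_coarsenings[OF partitioned_treeD[OF T']]
  have "(\<Sum>K\<in>coarsenings U. F (U\<lparr>blocks := K\<rparr>)) =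
    (\<Sum>(J, J', B)\<in>(SIGMA J:coarsenings T. coarsenings T' \<times> attach (T\<lparr>blocks := J\<rparr>) S).
      F (join (T\<lparr>blocks := J\<rparr>) S B (T'\<lparr>blocks := J'\<rparr>)))"
    using sum.reindex_bij_betw[OF bij_betw_coarsenings_join[OF T T' S ne], of "\<lambda>K. F (U\<lparr>blocks := K\<rparr>)"]
    by (simp add: U_def[symmetric] eq case_prod_unfold)
  also have "\<dots> = (\<Sum>J\<in>coarsenings T. \<Sum>(J', B)\<in>coarsenings T' \<times> attach (T\<lparr>blocks := J\<rparr>) S.
      F (join (T\<lparr>blocks := J\<rparr>) S B (T'\<lparr>blocks := J'\<rparr>)))"
    using fin finite_attach[OF partitioned_treeD[OF partitioned_tree_blocks[OF T]]]
    by (subst sum.Sigma[symmetric]) (auto simp: case_prod_unfold)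
  finally show ?thesis by (simp add: sum.cartesian_product)
qed

section \<open>Products and isomorphisms\<close>

text \<open>Injectivity enters because removing the block \<open>B\<close> must commute with taking
  images: two different blocks may not acquire the same image.\<close>

lemma image_glue:
  assumes f: "inj_on f V" "I \<subseteq> Pow V" "B \<subseteq> V" and g: "inj_on g W" "J \<subseteq> Pow W" "C \<subseteq> W"
  shows "(`) (map_sum f g) ` glue I B J C = glue ((`) f ` I) (f ` B) ((`) g ` J) (g ` C)"
proof -
  have I: "(`) f ` (I - {B}) = (`) f ` I - {f ` B}"
    using inj_on_image_set_diff[OF inj_on_image_Pow[OF f(1)], of I "{B}"] f by auto
  have J: "(`) g ` (J - {C}) = (`) g ` J - {g ` C}"
    using inj_on_image_set_diff[OF inj_on_image_Pow[OF g(1)], of J "{C}"] g by auto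
  have M: "map_sum f g ` (B <+> C) = f ` B <+> g ` C"
    by (simp add: Plus_def image_Un image_image)
  have E: "f ` B <+> g ` C = {} \<longleftrightarrow> B <+> C = {}" by auto
  have "(`) (map_sum f g) ` ({B <+> C} - {{}}) = {f ` B <+> g ` C} - {{}}"
    unfolding M[symmetric] by (cases "B <+> C = {}") auto
  then show ?thesis
    unfolding glue_def I[symmetric] J[symmetric] by (simp add: image_Un image_image)
qed

lemma iso_by_join:
  assumes f: "iso_by f T U" and g: "iso_by g T' U'"
    and T: "partitioned_forest T" and T': "partitioned_forest T'" and B: "B \<subseteq> verts T"
  shows "iso_by (map_sum f g) (join T S B T') (join U (f ` S) (f ` B) U')"
proof -
  have F: "inj_on f (verts T)" "verts U = f ` verts T" "edges U = map_prod f f ` edges T"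
    "blocks U = (`) f ` blocks T" "\<And>v. v \<in> verts T \<Longrightarrow> deco U (f v) = deco T v"
    and G: "inj_on g (verts T')" "verts U' = g ` verts T'" "edges U' = map_prod g g ` edges T'"
    "blocks U' = (`) g ` blocks T'" "\<And>v. v \<in> verts T' \<Longrightarrow> deco U' (g v) = deco T' v"
    using f g by (simp_all add: iso_by_def bij_betw_def)
  have r: "roots U' = g ` roots T'" by (rule iso_by_roots[OF g T'])
  have "bij_betw (map_sum f g) (verts (join T S B T')) (verts (join U (f ` S) (f ` B) U'))"
    unfolding bij_betw_def
  proof
    show "inj_on (map_sum f g) (verts (join T S B T'))"
      using inj_onD[OF F(1)] inj_onD[OF G(1)] by (intro inj_onI) (auto elim!: PlusE)
    show "map_sum f g ` verts (join T S B T') = verts (join U (f ` S) (f ` B) U')"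
      by (simp add: F(2) G(2) Plus_def image_Un image_image)
  qed
  moreover have "edges (join U (f ` S) (f ` B) U') =
      map_prod (map_sum f g) (map_sum f g) ` edges (join T S B T')"
  proof -
    have "map_prod (map_sum f g) (map_sum f g) ` (Inl ` S \<times> Inr ` roots T') = Inl ` f ` S \<times> Inr ` g ` roots T'"
      by (simp add: map_prod_surj_on[OF refl refl] image_image)
    then show ?thesis
      by (simp add: join_def F(3) G(3) r image_Un image_image map_prod_compose[symmetric]
          prod.map_comp comp_def)
  qed
  moreover have "blocks (join U (f ` S) (f ` B) U') = (`) (map_sum f g) ` blocks (join T S B T')"
  proof -
    have sub: "blocks T \<subseteq> Pow (verts T)" "blocks T' \<subseteq> Pow (verts T')" "roots T' \<subseteq> verts T'"
      using partitioned_forestD(7)[OF T] partitioned_forestD(7)[OF T'] by (auto simp: roots_def)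
    show ?thesis
      by (simp add: F(4) G(4) r image_glue[OF F(1) sub(1) B G(1) sub(2,3)])
  qed
  moreover have "deco (join U (f ` S) (f ` B) U') (map_sum f g v) = deco (join T S B T') v"
    if "v \<in> verts (join T S B T')" for v
    using that F(5) G(5) by auto
  ultimately show ?thesis by (auto simp: iso_by_def)
qed

lemma iso_by_attach:
  assumes f: "iso_by f T U" and T: "partitioned_forest T" and S: "S \<subseteq> verts T"
  shows "attach U (f ` S) = (`) f ` attach T S"
proof (cases "S = {}")
  case True
  then show ?thesis using iso_by_roots[OF f T] by (simp add: attach_def)
next
  case False
  have inj: "inj_on f (verts T)" and b: "blocks U = (`) f ` blocks T"
    using f by (simp_all add: iso_by_def bij_betw_def)
  have "parents U (f v) = f ` S \<longleftrightarrow> parents T v = S" if "v \<in> verts T" for v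
    using iso_by_parents[OF f T that] inj_on_image_eq_iff[OF inj parents_subset[OF T] S] by simp
  then have "(\<forall>v\<in>f ` B. parents U v = f ` S) \<longleftrightarrow> (\<forall>v\<in>B. parents T v = S)" if "B \<in> blocks T" for B
    using partitioned_forestD(7)[OF T that] by (auto simp: subset_iff)
  then have "{B \<in> blocks U. \<forall>v\<in>B. parents U v = f ` S} = (`) f ` {B \<in> blocks T. \<forall>v\<in>B. parents T v = S}"
    unfolding b by (auto simp: image_iff)
  then show ?thesis using False by (simp add: attach_def)
qed

lemma attach_subset:
  assumes "partitioned_tree T" "B \<in> attach T S"
  shows "B \<subseteq> verts T"
  using attachD(1)[OF assms] partitioned_forestD(7)[OF partitioned_treeD[OF assms(1)]] by auto

text \<open>Independence of representatives for both graftings: vertices are reindexed by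
  \<open>f\<close>, attachable blocks by images under \<open>f\<close>, and corresponding joins are
  isomorphic by \<open>iso_by_join\<close>.\<close>

lemma sum_iso_class_join_cong:
  assumes f: "iso_by f T U" and g: "iso_by g T' U'"
    and T: "partitioned_tree T" and T': "partitioned_tree T'"
  shows "(\<Sum>s\<in>verts U. \<Sum>B\<in>attach U {s}. F (iso_class (join U {s} B U'))) =
    (\<Sum>s\<in>verts T. \<Sum>B\<in>attach T {s}. F (iso_class (join T {s} B T')))" (is ?diamond)
    and "(\<Sum>s\<in>verts U. F (iso_class (join U {s} {} U'))) =
    (\<Sum>s\<in>verts T. F (iso_class (join T {s} {} T')))" (is ?bullet)
proof -
  note pT = partitioned_treeD[OF T] and pT' = partitioned_treeD[OF T']
  have bij: "bij_betw f (verts T) (verts U)" using f by (simp add: iso_by_def)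
  then have inj: "inj_on f (verts T)" by (simp add: bij_betw_def)
  have eq: "iso_class (join U {f s} (f ` B) U') = iso_class (join T {s} B T')"
    if "s \<in> verts T" "B \<in> attach T {s}" for s B
  proof -
    have "attachable T {s}" using that(1) by (simp add: attachable_def)
    then have "partitioned_forest (join T {s} B T')"
      using partitioned_treeD[OF partitioned_tree_join[OF T T' _ that(2)]] by simp
    with iso_class_eqI[OF iso_by_join[OF f g pT pT' attach_subset[OF T that(2)]], of "{s}"]
    show ?thesis by simp
  qed
  have "(\<Sum>B\<in>attach U {f s}. F (iso_class (join U {f s} B U'))) =
      (\<Sum>B\<in>attach T {s}. F (iso_class (join T {s} B T')))" if "s \<in> verts T" for s
  proof -
    have "attach U {f s} = (`) f ` attach T {s}" using iso_by_attach[OF f pT, of "{s}"] that by simp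
    moreover have "inj_on ((`) f) (attach T {s})"
      by (rule inj_on_subset[OF inj_on_image_Pow[OF inj]]) (use attach_subset[OF T] in auto)
    ultimately show ?thesis using eq[OF that] by (simp add: sum.reindex)
  qed
  then show ?diamond by (simp flip: sum.reindex_bij_betw[OF bij])
  have "iso_class (join U {f s} {} U') = iso_class (join T {s} {} T')" if "s \<in> verts T" for s
    using eq[OF that, of "{}"] by (simp add: attach_def)
  then show ?bullet by (simp flip: sum.reindex_bij_betw[OF bij])
qed

text \<open>With no vertices in \<open>T'\<close> the join adds neither edges nor blocks and only
  relabels the vertices of \<open>T\<close>.\<close>

lemma iso_by_empty_right:
  assumes "partitioned_tree T" "partitioned_tree T'" "verts T' = {}"
  shows "iso_by Inl T (join T {s} {} T')"
proof (rule iso_by_inj)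
  note P = partitioned_forestD[OF partitioned_treeD[OF assms(2)]]
  have "edges T' = {}" "roots T' = {}" "blocks T' = {}"
    using P(2,4) assms(3) by (auto simp: roots_def partition_on_empty)
  then show "edges (join T {s} {} T') = map_prod Inl Inl ` edges T"
    "blocks (join T {s} {} T') = (`) Inl ` blocks T"
    using partitioned_forestD(8)[OF partitioned_treeD[OF assms(1)]]
    by (auto simp: join_def glue_def)
qed (use assms(3) in \<open>auto simp: Plus_def\<close>)

section \<open>Identities between iterated products of trees\<close>

text \<open>Iterated joins live on nested sum types. This relabelling and \<open>sum_swap\<close>
  are the isomorphisms behind all identities between triple products below.\<close>

definition sum_assoc :: "('a + 'b) + 'c \<Rightarrow> 'a + ('b + 'c)" where
  "sum_assoc = case_sum (case_sum Inl (Inr \<circ> Inl)) (Inr \<circ> Inr)"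

definition sum_swap :: "('a + 'b) + 'c \<Rightarrow> ('a + 'c) + 'b" where
  "sum_swap = case_sum (case_sum (Inl \<circ> Inl) Inr) (Inl \<circ> Inr)"

lemma sum_assoc_simps [simp]:
  "sum_assoc (Inl (Inl a)) = Inl a" "sum_assoc (Inl (Inr b)) = Inr (Inl b)"
  "sum_assoc (Inr c) = Inr (Inr c)"
  by (simp_all add: sum_assoc_def)

lemma sum_swap_simps [simp]:
  "sum_swap (Inl (Inl a)) = Inl (Inl a)" "sum_swap (Inl (Inr b)) = Inr b"
  "sum_swap (Inr c) = Inl (Inr c)"
  by (simp_all add: sum_swap_def)

lemma inj_sum_assoc: "inj sum_assoc"
  by (auto simp: inj_on_def sum_assoc_def split: sum.splits)

lemma inj_sum_swap: "inj sum_swap"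
  by (auto simp: inj_on_def sum_swap_def split: sum.splits)

text \<open>In an iterated merge the block fused first is the root block that the second merge takes
  out again; this computes what remains. The fused block is told apart from the others by its
  preimages on the two sides.\<close>

lemma glue_diff:
  fixes B :: "'a set" and C :: "'b set"
  shows "glue I B J C - {B <+> C} = (`) Inl ` (I - {B}) \<union> (`) Inr ` (J - {C})"
proof -
  have "Inl ` X \<noteq> B <+> C" if "X \<noteq> B" for X
  proof
    assume "Inl ` X = B <+> C"
    then have "Inl -` (Inl ` X :: ('a + 'b) set) = Inl -` (B <+> C)" by simp
    with that show False by auto
  qed
  moreover have "Inr ` X \<noteq> B <+> C" if "X \<noteq> C" for X
  proof
    assume "Inr ` X = B <+> C"
    then have "Inr -` (Inr ` X :: ('a + 'b) set) = Inr -` (B <+> C)" by simp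
    with that show False by auto
  qed
  ultimately show ?thesis unfolding glue_def by blast
qed

text \<open>After growing, the root block is an image under \<open>Inl\<close>. It could coincide
  with an image under \<open>Inr\<close> only if both were empty, which the hypothesis
  excludes.\<close>

lemma image_Inl_Un_Inr_diff:
  assumes "{} \<notin> J"
  shows "(`) Inl ` I \<union> (`) Inr ` J - {Inl ` R} = (`) Inl ` (I - {R}) \<union> (`) Inr ` J"
proof -
  have "Inr ` Y \<noteq> Inl ` R" if "Y \<in> J" for Y using that assms by (metis Inl_Inr_False equals0I image_iff)
  then have "Inl ` R \<notin> (`) Inr ` J" by fastforce
  moreover have "(`) Inl ` I - {Inl ` R} = (`) Inl ` (I - {R})"
    by (auto simp: inj_image_eq_iff)
  ultimately show ?thesis by blast
qed

lemma blocks_grow: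
  assumes "partitioned_tree T" "partitioned_tree T'"
  shows "blocks (join T {s} {} T') = (`) Inl ` blocks T \<union> (`) Inr ` blocks T'"
  using glue_eq_None[OF partitioned_forestD(4)[OF partitioned_treeD[OF assms(1)]]
    partitioned_tree_roots[OF assms(2)] partitioned_forestD(4)[OF partitioned_treeD[OF assms(2)]]]
  by simp

abbreviation merge where "merge T T' \<equiv> join T {} (roots T) T'"

abbreviation grow where "grow T s T' \<equiv> join T {s} {} T'"

lemma partitioned_tree_merge:
  "partitioned_tree T \<Longrightarrow> partitioned_tree T' \<Longrightarrow> partitioned_tree (merge T T')"
  using partitioned_tree_join[of T T' "{}" "roots T"] by (simp add: attachable_def attach_def)

lemma partitioned_tree_grow:
  "partitioned_tree T \<Longrightarrow> partitioned_tree T' \<Longrightarrow> s \<in> verts T \<Longrightarrow> partitioned_tree (grow T s T')"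
  by (rule partitioned_tree_join) (simp_all add: attachable_def attach_def)

lemma roots_merge: "partitioned_tree T' \<Longrightarrow> roots (merge T T') = roots T <+> roots T'"
  by (simp add: roots_join partitioned_treeD)

lemma roots_grow: "partitioned_tree T' \<Longrightarrow> roots (grow T s T') = Inl ` roots T"
  by (simp add: roots_join partitioned_treeD)

lemma edges_grow: "edges (grow T s T') = map_prod Inl Inl ` edges T \<union> map_prod Inr Inr ` edges T' \<union>
    (\<lambda>r. (Inl s, Inr r)) ` roots T'"
  by (auto simp: join_def)

lemma edges_merge: "edges (merge T T') = map_prod Inl Inl ` edges T \<union> map_prod Inr Inr ` edges T'"
  by (simp add: join_def)

lemma image_singleton_diff: "(`) f ` ({M} - {{}}) = {f ` M} - {{}}"
  by (cases "M = {}") auto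

lemma merge_commute:
  assumes "partitioned_tree A" "partitioned_tree B"
  shows "iso_class (merge A B) = iso_class (merge B A)"
proof (rule iso_class_eqI)
  have "inj (case_sum Inr Inl)" by (auto simp: inj_on_def split: sum.splits)
  then show "iso_by (case_sum Inr Inl) (merge A B) (merge B A)"
  proof (rule iso_by_inj)
    have "case_sum Inr Inl ` (roots A <+> roots B) = roots B <+> roots A"
      by (simp add: Plus_def image_Un image_image Un_commute)
    then have eq: "(`) (case_sum Inr Inl) ` ({roots A <+> roots B} - {{}}) = {roots B <+> roots A} - {{}}"
      by (simp only: image_singleton_diff)
    show "blocks (merge B A) = (`) (case_sum Inr Inl) ` blocks (merge A B)"
      unfolding join_simps glue_def image_Un eq by (simp add: image_image Un_ac)
    show "edges (merge B A) = map_prod (case_sum Inr Inl) (case_sum Inr Inl) ` edges (merge A B)"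
      by (simp add: edges_merge image_Un image_image map_prod_def case_prod_beta Un_ac)
  qed (auto simp: Plus_def image_Un image_image)
qed (intro partitioned_treeD partitioned_tree_merge assms)

lemma merge_assoc:
  assumes A: "partitioned_tree A" and B: "partitioned_tree B" and C: "partitioned_tree C"
  shows "iso_class (merge (merge A B) C) = iso_class (merge A (merge B C))"
proof (rule iso_class_eqI)
  show "iso_by sum_assoc (merge (merge A B) C) (merge A (merge B C))"
  proof (rule iso_by_inj[OF inj_sum_assoc])
    have "sum_assoc ` ((roots A <+> roots B) <+> roots C) = roots A <+> (roots B <+> roots C)"
      by (simp add: Plus_def image_Un image_image Un_ac)
    then have eq: "(`) sum_assoc ` ({(roots A <+> roots B) <+> roots C} - {{}}) =
        {roots A <+> (roots B <+> roots C)} - {{}}"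
      by (simp only: image_singleton_diff)
    show "blocks (merge A (merge B C)) = (`) sum_assoc ` blocks (merge (merge A B) C)"
      unfolding join_simps roots_merge[OF B] roots_merge[OF C] glue_def[of "glue _ _ _ _"]
        glue_def[of _ _ "glue _ _ _ _"] glue_diff image_Un eq
      by (simp add: image_image Un_ac)
    show "edges (merge A (merge B C)) = map_prod sum_assoc sum_assoc ` edges (merge (merge A B) C)"
      by (simp add: edges_merge image_Un image_image map_prod_def case_prod_beta Un_ac)
  qed (auto simp: Plus_def image_Un image_image)
qed (intro partitioned_treeD partitioned_tree_merge A B C)

text \<open>\<open>C\<close> hangs from a vertex of \<open>B\<close>, so growing it leaves the roots
  of \<open>B\<close> as they were, and the outer grafting adds the same edges in either
  order.\<close>

lemma grow_grow_above:
  assumes A: "partitioned_tree A" and B: "partitioned_tree B" and C: "partitioned_tree C"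
    and s: "s \<in> verts A" and u: "u \<in> verts B"
  shows "iso_class (grow (grow A s B) (Inr u) C) = iso_class (grow A s (grow B u C))"
proof (rule iso_class_eqI)
  note T = partitioned_tree_grow[OF A B s] partitioned_tree_grow[OF B C u]
  show "iso_by sum_assoc (grow (grow A s B) (Inr u) C) (grow A s (grow B u C))"
  proof (rule iso_by_inj[OF inj_sum_assoc])
    show "blocks (grow A s (grow B u C)) = (`) sum_assoc ` blocks (grow (grow A s B) (Inr u) C)"
      unfolding blocks_grow[OF A T(2)] blocks_grow[OF T(1) C] blocks_grow[OF A B] blocks_grow[OF B C]
      by (simp add: image_Un image_image Un_ac)
    show "edges (grow A s (grow B u C)) = map_prod sum_assoc sum_assoc ` edges (grow (grow A s B) (Inr u) C)"
      unfolding edges_grow edges_merge roots_grow[OF C] 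
      by (simp add: image_Un image_image map_prod_def case_prod_beta Un_ac)
  qed (auto simp: Plus_def image_Un image_image)
qed (intro partitioned_treeD partitioned_tree_grow A B C; use s u in \<open>simp add: InrI\<close>)

text \<open>The case \<open>s = u\<close> is included: since no blocks are merged, the two root
  blocks become separate blocks of children of \<open>s\<close>, and the order of grafting leaves no
  trace.\<close>

lemma grow_grow_swap:
  assumes A: "partitioned_tree A" and B: "partitioned_tree B" and C: "partitioned_tree C"
    and s: "s \<in> verts A" and u: "u \<in> verts A"
  shows "iso_class (grow (grow A s B) (Inl u) C) = iso_class (grow (grow A u C) (Inl s) B)"
proof (rule iso_class_eqI)
  note T = partitioned_tree_grow[OF A B s] partitioned_tree_grow[OF A C u]
  show "iso_by sum_swap (grow (grow A s B) (Inl u) C) (grow (grow A u C) (Inl s) B)"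
  proof (rule iso_by_inj[OF inj_sum_swap])
    show "blocks (grow (grow A u C) (Inl s) B) = (`) sum_swap ` blocks (grow (grow A s B) (Inl u) C)"
      unfolding blocks_grow[OF T(1) C] blocks_grow[OF T(2) B] blocks_grow[OF A B] blocks_grow[OF A C]
      by (simp add: image_Un image_image Un_ac)
    show "edges (grow (grow A u C) (Inl s) B) = map_prod sum_swap sum_swap ` edges (grow (grow A s B) (Inl u) C)"
      unfolding edges_grow edges_merge
      by (simp add: image_Un image_image map_prod_def case_prod_beta Un_ac)
  qed (auto simp: Plus_def image_Un image_image)
qed (intro partitioned_treeD partitioned_tree_grow A B C; use s u in \<open>simp add: InlI\<close>)

lemma image_sum_swap_Plus: "sum_swap ` Inl ` (X <+> Y) = Inl ` X <+> Y"
  by (simp add: Plus_def image_Un image_image)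

lemma image_sum_swap_block: "(`) sum_swap ` (`) Inl ` ({X <+> Y} - {{}}) = {Inl ` X <+> Y} - {{}}"
  by (simp only: image_singleton_diff image_sum_swap_Plus)

lemma image_sum_assoc_Plus: "sum_assoc ` Inl ` (X <+> Y) = X <+> Inl ` Y"
  by (simp add: Plus_def image_Un image_image)

lemma image_sum_assoc_block: "(`) sum_assoc ` (`) Inl ` ({X <+> Y} - {{}}) = {X <+> Inl ` Y} - {{}}"
  by (simp only: image_singleton_diff image_sum_assoc_Plus)

text \<open>Growing \<open>C\<close> on a vertex of \<open>A\<close> does not touch the root block
  of \<open>A\<close>, so it commutes with merging the roots. Together with
  \<open>grow_merge_right\<close> this covers all vertices of the merge and gives the two summands
  of the Leibniz rule.\<close>

lemma grow_merge_left:
  assumes A: "partitioned_tree A" and B: "partitioned_tree B" and C: "partitioned_tree C"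
    and u: "u \<in> verts A"
  shows "iso_class (grow (merge A B) (Inl u) C) = iso_class (merge (grow A u C) B)"
proof (rule iso_class_eqI)
  note T = partitioned_tree_merge[OF A B] partitioned_tree_grow[OF A C u]
  show "iso_by sum_swap (grow (merge A B) (Inl u) C) (merge (grow A u C) B)"
  proof (rule iso_by_inj[OF inj_sum_swap])
    show "blocks (merge (grow A u C) B) = (`) sum_swap ` blocks (grow (merge A B) (Inl u) C)"
    proof -
      show ?thesis
        unfolding blocks_grow[OF T(1) C] join_simps(2)[of "grow A u C"] blocks_grow[OF A C] roots_grow[OF C]
          glue_def[of _ "Inl ` roots A"]
          image_Inl_Un_Inr_diff[OF partitioned_forestD(8)[OF partitioned_treeD[OF C]]]
        unfolding join_simps glue_def image_Un image_sum_swap_block by (simp add: image_image Un_ac)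
    qed
    show "edges (merge (grow A u C) B) = map_prod sum_swap sum_swap ` edges (grow (merge A B) (Inl u) C)"
      unfolding edges_grow edges_merge
      by (simp add: image_Un image_image map_prod_def case_prod_beta Un_ac)
  qed (auto simp: Plus_def image_Un image_image)
qed (intro partitioned_treeD partitioned_tree_grow partitioned_tree_merge A B C; use u in \<open>simp add: InlI\<close>)

lemma grow_merge_right:
  assumes A: "partitioned_tree A" and B: "partitioned_tree B" and C: "partitioned_tree C"
    and u: "u \<in> verts B"
  shows "iso_class (grow (merge A B) (Inr u) C) = iso_class (merge A (grow B u C))"
proof (rule iso_class_eqI)
  note T = partitioned_tree_merge[OF A B] partitioned_tree_grow[OF B C u]
  show "iso_by sum_assoc (grow (merge A B) (Inr u) C) (merge A (grow B u C))"
  proof (rule iso_by_inj[OF inj_sum_assoc])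
    show "blocks (merge A (grow B u C)) = (`) sum_assoc ` blocks (grow (merge A B) (Inr u) C)"
    proof -
      show ?thesis
        unfolding blocks_grow[OF T(1) C] join_simps(2)[of A] blocks_grow[OF B C] roots_grow[OF C]
          glue_def[of _ _ _ "Inl ` roots B"]
          image_Inl_Un_Inr_diff[OF partitioned_forestD(8)[OF partitioned_treeD[OF C]]]
        unfolding join_simps glue_def image_Un image_sum_assoc_block by (simp add: image_image Un_ac)
    qed
    show "edges (merge A (grow B u C)) = map_prod sum_assoc sum_assoc ` edges (grow (merge A B) (Inr u) C)"
      unfolding edges_grow edges_merge roots_grow[OF C]
      by (simp add: image_Un image_image map_prod_def case_prod_beta Un_ac)
  qed (auto simp: Plus_def image_Un image_image)
qed (intro partitioned_treeD partitioned_tree_grow partitioned_tree_merge A B C; use u in \<open>simp add: InrI\<close>)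

section \<open>Products and \<open>\<Psi>\<close> on the basis\<close>

lemma PT_E:
  assumes "X \<in> PT D"
  obtains T :: "(nat, 'd) pforest" where "partitioned_tree T" "deco T ` verts T \<subseteq> D" "X = iso_class T"
  using assms by (auto simp: PT_def)

lemma rep_E:
  assumes "partitioned_tree T"
  obtains f where "iso_by f T (rep (iso_class T))" "partitioned_tree (rep (iso_class T))"
    "verts (rep (iso_class T)) = f ` verts T" "inj_on f (verts T)"
proof -
  obtain f where f: "iso_by f T (rep (iso_class T))"
    using rep_iso_class[OF partitioned_treeD[OF assms]] .
  moreover have "verts (rep (iso_class T)) = f ` verts T" "inj_on f (verts T)"
    using f by (simp_all add: iso_by_def bij_betw_def)
  ultimately show ?thesis using that iso_by_partitioned_tree[OF f assms] by blast
qed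

text \<open>Replaces the representatives in the definition by arbitrary trees over any vertex type,
  so that products can be iterated without returning to \<open>nat\<close>.\<close>

lemma cp_dot_basis:
  assumes T: "partitioned_tree T" and T': "partitioned_tree T'"
  shows "cp_dot (basis (iso_class T)) (basis (iso_class T')) = basis (iso_class (merge T T'))"
proof -
  obtain f where f: "iso_by f T (rep (iso_class T))" by (rule rep_E[OF T])
  obtain g where g: "iso_by g T' (rep (iso_class T'))" by (rule rep_E[OF T'])
  have "roots T \<subseteq> verts T" by (auto simp: roots_def)
  from iso_by_join[OF f g partitioned_treeD[OF T] partitioned_treeD[OF T'] this, of "{}"]
  have "iso_class (merge T T') = iso_class (merge (rep (iso_class T)) (rep (iso_class T')))"
    using partitioned_treeD[OF partitioned_tree_merge[OF T T']]
    by (auto simp: iso_by_roots[OF f partitioned_treeD[OF T]] dest: iso_class_eqI)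
  then show ?thesis by (simp add: cp_dot_def merge_roots_eq)
qed

text \<open>Shows that the separate clause for an empty second factor is an instance of the general
  sum, so \<open>cp_bullet_basis\<close> needs no case distinction.\<close>

lemma sum_grow_empty:
  assumes T: "partitioned_tree T" and T': "partitioned_tree T'" and "verts T' = {}"
  shows "(\<Sum>s\<in>verts T. basis (iso_class (grow T s T'))) =
    scale (of_nat (card (verts T))) (basis (iso_class T))"
proof -
  have "iso_class (grow T s T') = iso_class T" for s
    using iso_class_eqI[OF iso_by_empty_right[OF assms] partitioned_treeD[OF T]] by simp
  then show ?thesis by (simp add: scale.sum_constant_scale)
qed

lemma card_rep: "partitioned_tree T \<Longrightarrow> card (verts (rep (iso_class T))) = card (verts T)"
  by (rule rep_E) (auto simp: card_image)

lemma verts_rep_empty: "partitioned_tree T \<Longrightarrow> verts (rep (iso_class T)) = {} \<longleftrightarrow> verts T = {}"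
  by (rule rep_E) auto

lemma cp_bullet_basis:
  assumes T: "partitioned_tree T" and T': "partitioned_tree T'"
  shows "cp_bullet (basis (iso_class T)) (basis (iso_class T')) =
    (\<Sum>s\<in>verts T. basis (iso_class (grow T s T')))"
proof (cases "verts T' = {}")
  case True
  then show ?thesis
    by (simp add: cp_bullet_def Let_def verts_rep_empty[OF T'] card_rep[OF T] sum_grow_empty[OF T T'])
next
  case False
  let ?U = "rep (iso_class T)" and ?U' = "rep (iso_class T')"
  obtain f where f: "iso_by f T ?U" "partitioned_tree ?U" by (rule rep_E[OF T])
  obtain g where g: "iso_by g T' ?U'" "partitioned_tree ?U'" by (rule rep_E[OF T'])
  have "graft ?U s None ?U' = grow ?U s ?U'" for s
    using graft_eq[OF f(2) g(2), of None s] by simp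
  with False show ?thesis
    by (simp add: cp_bullet_def Let_def verts_rep_empty[OF T'] sum_iso_class_join_cong(2)[OF f(1) g(1) T T'])
qed

lemma cp_diamond_basis:
  assumes T: "partitioned_tree T" and T': "partitioned_tree T'" and ne: "verts T' \<noteq> {}"
  shows "cp_diamond (basis (iso_class T)) (basis (iso_class T')) =
    (\<Sum>s\<in>verts T. \<Sum>B\<in>attach T {s}. basis (iso_class (join T {s} B T')))"
proof -
  let ?U = "rep (iso_class T)" and ?U' = "rep (iso_class T')"
  obtain f where f: "iso_by f T ?U" "partitioned_tree ?U" by (rule rep_E[OF T])
  obtain g where g: "iso_by g T' ?U'" "partitioned_tree ?U'" by (rule rep_E[OF T'])
  show ?thesis
    using ne by (simp add: cp_diamond_def Let_def verts_rep_empty[OF T']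
      sum_graft_attach[OF f(2) g(2), where F = "\<lambda>U. basis (iso_class U)"]
      sum_iso_class_join_cong(1)[OF f(1) g(1) T T'] del: sum.insert)
qed

lemma cp_diamond_basis_empty:
  assumes T: "partitioned_tree T" and T': "partitioned_tree T'" and "verts T' = {}"
  shows "cp_diamond (basis (iso_class T)) (basis (iso_class T')) =
    scale (of_nat (card (verts T))) (basis (iso_class T))"
  using assms(3) by (simp add: cp_diamond_def Let_def verts_rep_empty[OF T'] card_rep[OF T])

section \<open>Coarsenings under isomorphism, and \<open>Psi\<close> on basis elements\<close>

lemma iso_by_coarsenings_into:
  assumes f: "iso_by f T U" and T: "partitioned_tree T" and J: "J \<in> coarsenings T"
  shows "(`) ((`) f) J \<in> coarsenings U" "iso_by f (T\<lparr>blocks := J\<rparr>) (U\<lparr>blocks := (`) ((`) f) J\<rparr>)"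
proof -
  let ?K = "(`) ((`) f) J"
  have U: "verts U = f ` verts T" "blocks U = (`) f ` blocks T" "inj_on f (verts T)"
    using f by (simp_all add: iso_by_def bij_betw_def)
  show iso: "iso_by f (T\<lparr>blocks := J\<rparr>) (U\<lparr>blocks := ?K\<rparr>)" using f by (simp add: iso_by_def)
  have P: "partitioned_forest (U\<lparr>blocks := ?K\<rparr>)"
    by (rule iso_by_partitioned_forest[OF iso partitioned_treeD[OF partitioned_tree_blocks[OF T J]]])
  have "partition_on (verts U) (blocks U)"
    unfolding U(1,2) by (rule partition_on_image[OF _ U(3)])
      (rule partitioned_forestD(4)[OF partitioned_treeD[OF T]])
  moreover have "partition_on (verts U) ?K" using partitioned_forestD(4)[OF P] by simp
  moreover have "\<exists>Y\<in>?K. X \<subseteq> Y" if X: "X \<in> blocks U" for X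
  proof -
    obtain Z where "Z \<in> blocks T" "X = f ` Z" using X unfolding U(2) by blast
    moreover from this obtain Y where "Y \<in> J" "Z \<subseteq> Y" using coarseningsD(2)[OF J] by blast
    ultimately show ?thesis by (auto intro!: bexI[of _ "f ` Y"])
  qed
  moreover have "parents U u = parents U v" if "X \<in> ?K" "u \<in> X" "v \<in> X" for X u v
    using partitioned_forestD(6)[OF P, of X u v] that by simp
  ultimately show "?K \<in> coarsenings U"
    unfolding coarsenings_def refines_def mem_Collect_eq by blast
qed

lemma bij_betw_coarsenings_iso:
  assumes f: "iso_by f T U" and T: "partitioned_tree T"
  shows "bij_betw ((`) ((`) f)) (coarsenings T) (coarsenings U)"
proof -
  let ?g = "inv_into (verts T) f"
  have g: "iso_by ?g U T" by (rule iso_by_sym[OF f partitioned_treeD[OF T]])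
  have U: "partitioned_tree U" by (rule iso_by_partitioned_tree[OF f T])
  have bij: "inj_on f (verts T)" "verts U = f ` verts T"
    using f by (simp_all add: iso_by_def bij_betw_def)
  have sub: "X \<subseteq> V" if "partition_on V J" "X \<in> J" for X V and J :: "'x set set"
    using that by (auto simp: partition_on_def)
  show ?thesis
  proof (rule bij_betw_byWitness[where f' = "(`) ((`) ?g)"])
    show "\<forall>J\<in>coarsenings T. (`) ((`) ?g) ((`) ((`) f) J) = J"
    proof
      fix J assume J: "J \<in> coarsenings T"
      have "?g ` f ` X = X" if "X \<in> J" for X
        using sub[OF coarseningsD(1)[OF J] that] bij(1) by (auto simp: image_image subset_iff image_iff)
      then show "(`) ((`) ?g) ((`) ((`) f) J) = J" by (simp add: image_image)
    qed
    show "\<forall>K\<in>coarsenings U. (`) ((`) f) ((`) ((`) ?g) K) = K"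
    proof
      fix K assume K: "K \<in> coarsenings U"
      have "f ` ?g ` X = X" if "X \<in> K" for X
      proof -
        have "f (?g x) = x" if "x \<in> X" for x
          using sub[OF coarseningsD(1)[OF K] \<open>X \<in> K\<close>] that bij(2) by (auto intro: f_inv_into_f)
        then show ?thesis by (simp add: image_image)
      qed
      then show "(`) ((`) f) ((`) ((`) ?g) K) = K" by (simp add: image_image)
    qed
    show "(`) ((`) f) ` coarsenings T \<subseteq> coarsenings U"
      using iso_by_coarsenings_into(1)[OF f T] by (rule image_subsetI)
    show "(`) ((`) ?g) ` coarsenings U \<subseteq> coarsenings T"
      using iso_by_coarsenings_into(1)[OF g U] by (rule image_subsetI)
  qed
qed

text \<open>An isomorphism to the representative carries coarsenings bijectively to coarsenings and
  each coarsened tree to an isomorphic one, so the multiplicities agree.\<close>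

lemma Psi_basis:
  assumes T: "partitioned_tree T"
  shows "Psi (basis (iso_class T)) = (\<Sum>J\<in>coarsenings T. basis (iso_class (T\<lparr>blocks := J\<rparr>)))"
proof -
  let ?U = "rep (iso_class T)"
  obtain f where f: "iso_by f T ?U" "partitioned_tree ?U" by (rule rep_E[OF T])
  have "iso_class (T\<lparr>blocks := J\<rparr>) = iso_class (?U\<lparr>blocks := (`) ((`) f) J\<rparr>)" if "J \<in> coarsenings T" for J
    by (rule iso_class_eqI[OF iso_by_coarsenings_into(2)[OF f(1) T that]
        partitioned_treeD[OF partitioned_tree_blocks[OF T that]]])
  then show ?thesis
    by (simp add: Psi_def sum_coarser[OF f(2)]
        flip: sum.reindex_bij_betw[OF bij_betw_coarsenings_iso[OF f(1) T]])
qed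

lemma is_lin_Psi: "is_lin Psi"
  unfolding Psi_def by (rule is_lin_lin_ext)

lemma cp_bilinear:
  "cp_dot (x + y) z = cp_dot x z + cp_dot y z" "cp_dot z (x + y) = cp_dot z x + cp_dot z y"
  "cp_dot (scale r x) z = scale r (cp_dot x z)" "cp_dot z (scale r x) = scale r (cp_dot z x)"
  "cp_bullet (x + y) z = cp_bullet x z + cp_bullet y z" "cp_bullet z (x + y) = cp_bullet z x + cp_bullet z y"
  "cp_bullet (scale r x) z = scale r (cp_bullet x z)" "cp_bullet z (scale r x) = scale r (cp_bullet z x)"
  "cp_diamond (x + y) z = cp_diamond x z + cp_diamond y z"
  "cp_diamond z (x + y) = cp_diamond z x + cp_diamond z y"
  "cp_diamond (scale r x) z = scale r (cp_diamond x z)" "cp_diamond z (scale r x) = scale r (cp_diamond z x)"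
  unfolding cp_dot_def cp_bullet_def cp_diamond_def
  by (rule is_lin_add[OF is_lin_bilin_left] is_lin_add[OF is_lin_bilin_right]
    is_lin_scale[OF is_lin_bilin_left] is_lin_scale[OF is_lin_bilin_right])+

lemma is_lin_cp:
  "is_lin (\<lambda>x. cp_dot x z)" "is_lin (cp_dot z)" "is_lin (\<lambda>x. cp_bullet x z)" "is_lin (cp_bullet z)"
  "is_lin (\<lambda>x. cp_diamond x z)" "is_lin (cp_diamond z)"
  by (rule is_linI; simp add: cp_bilinear)+

lemma Psi_dot_basis:
  fixes T :: "('v, 'd) pforest" and T' :: "('w, 'd) pforest"
  assumes T: "partitioned_tree T" and T': "partitioned_tree T'"
  shows "Psi (cp_dot (basis (iso_class T)) (basis (iso_class T'))) =
    cp_dot (Psi (basis (iso_class T) :: 'd pclass \<Rightarrow>\<^sub>0 'k::field_char_0)) (Psi (basis (iso_class T')))"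
proof -
  have "cp_dot (Psi (basis (iso_class T) :: 'd pclass \<Rightarrow>\<^sub>0 'k::field_char_0)) (Psi (basis (iso_class T'))) =
    (\<Sum>J\<in>coarsenings T. \<Sum>J'\<in>coarsenings T'.
      basis (iso_class (merge (T\<lparr>blocks := J\<rparr>) (T'\<lparr>blocks := J'\<rparr>))))"
    by (simp add: Psi_basis[OF T] Psi_basis[OF T'] is_lin_sum[OF is_lin_cp(1)] is_lin_sum[OF is_lin_cp(2)]
      cp_dot_basis partitioned_tree_blocks[OF T] partitioned_tree_blocks[OF T'] sum.swap[of _ "coarsenings T'"]
      cong: sum.cong)
  \<comment> \<open>For \<open>S = {}\<close> the root block is the only member of
    \<open>attach\<close>; the one-term inner sum is inserted to match
    \<open>sum_coarsenings_join\<close>.\<close>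
  also have "\<dots> = (\<Sum>J\<in>coarsenings T. \<Sum>J'\<in>coarsenings T'. \<Sum>B\<in>attach (T\<lparr>blocks := J\<rparr>) {}.
      basis (iso_class (join (T\<lparr>blocks := J\<rparr>) {} B (T'\<lparr>blocks := J'\<rparr>))))"
    by (simp add: attach_def)
  also have "\<dots> = Psi (basis (iso_class (merge T T')))"
    using sum_coarsenings_join[OF T T', of "{}" "\<lambda>U. basis (iso_class U) :: 'd pclass \<Rightarrow>\<^sub>0 'k::field_char_0"]
    by (simp add: attachable_def Psi_basis[OF partitioned_tree_merge[OF T T']])
  finally show ?thesis by (simp add: cp_dot_basis[OF T T'])
qed

lemma Psi_bullet_basis:
  fixes T :: "('v, 'd) pforest" and T' :: "('w, 'd) pforest"
  assumes T: "partitioned_tree T" and T': "partitioned_tree T'"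
  shows "Psi (cp_bullet (basis (iso_class T)) (basis (iso_class T'))) =
    cp_diamond (Psi (basis (iso_class T) :: 'd pclass \<Rightarrow>\<^sub>0 'k::field_char_0)) (Psi (basis (iso_class T')))"
proof (cases "verts T' = {}")
  case True
  \<comment> \<open>The empty vertex set has only the empty partition, so the empty tree is its own
    sole coarsening.\<close>
  have c: "coarsenings T' = {{}}"
    using True partitioned_forestD(4)[OF partitioned_treeD[OF T']]
    by (auto simp: coarsenings_def refines_def partition_on_empty)
  have T'b: "partitioned_tree (T'\<lparr>blocks := {}\<rparr>)" using partitioned_tree_blocks[OF T'] c by simp
  have "cp_diamond (Psi (basis (iso_class T) :: 'd pclass \<Rightarrow>\<^sub>0 'k::field_char_0)) (Psi (basis (iso_class T'))) =
      (\<Sum>J\<in>coarsenings T. scale (of_nat (card (verts T))) (basis (iso_class (T\<lparr>blocks := J\<rparr>))))"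
    using True
    by (simp add: cp_diamond_basis_empty[OF partitioned_tree_blocks[OF T] T'b] Psi_basis[OF T] Psi_basis[OF T'] c is_lin_sum[OF is_lin_cp(5)] cong: sum.cong)
  also have "\<dots> = Psi (scale (of_nat (card (verts T))) (basis (iso_class T)))"
    by (simp add: is_lin_scale[OF is_lin_Psi] Psi_basis[OF T] scale.scale_sum_right)
  finally show ?thesis by (simp add: cp_bullet_basis[OF T T'] sum_grow_empty[OF T T' True])
next
  case False
  have "cp_diamond (Psi (basis (iso_class T) :: 'd pclass \<Rightarrow>\<^sub>0 'k::field_char_0)) (Psi (basis (iso_class T'))) =
    (\<Sum>J\<in>coarsenings T. \<Sum>J'\<in>coarsenings T'. \<Sum>s\<in>verts T. \<Sum>B\<in>attach (T\<lparr>blocks := J\<rparr>) {s}.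
      basis (iso_class (join (T\<lparr>blocks := J\<rparr>) {s} B (T'\<lparr>blocks := J'\<rparr>))))"
    using False
    by (simp add: cp_diamond_basis[OF partitioned_tree_blocks[OF T] partitioned_tree_blocks[OF T']]
      sum.swap[of _ "coarsenings T'" "coarsenings T"] Psi_basis[OF T] Psi_basis[OF T'] is_lin_sum[OF is_lin_cp(5)] is_lin_sum[OF is_lin_cp(6)]
      cong: sum.cong)
  \<comment> \<open>Coarsening does not change the vertices of \<open>T\<close>, so the sum over
    \<open>s\<close> can be moved outside; for a fixed \<open>s\<close> the remaining sums run over
    the coarsenings of \<open>grow T s T'\<close>.\<close>
  also have "\<dots> = (\<Sum>s\<in>verts T. \<Sum>J\<in>coarsenings T. \<Sum>J'\<in>coarsenings T'. \<Sum>B\<in>attach (T\<lparr>blocks := J\<rparr>) {s}.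
      basis (iso_class (join (T\<lparr>blocks := J\<rparr>) {s} B (T'\<lparr>blocks := J'\<rparr>))))"
    by (subst sum.swap[of _ "coarsenings T" "verts T"], rule sum.cong[OF refl], rule sum.swap)
  also have "\<dots> = (\<Sum>s\<in>verts T. Psi (basis (iso_class (grow T s T'))))"
  proof (rule sum.cong[OF refl])
    fix s assume s: "s \<in> verts T"
    show "(\<Sum>J\<in>coarsenings T. \<Sum>J'\<in>coarsenings T'. \<Sum>B\<in>attach (T\<lparr>blocks := J\<rparr>) {s}.
      basis (iso_class (join (T\<lparr>blocks := J\<rparr>) {s} B (T'\<lparr>blocks := J'\<rparr>)))) = Psi (basis (iso_class (grow T s T')) :: 'd pclass \<Rightarrow>\<^sub>0 'k::field_char_0)"
      using sum_coarsenings_join[OF T T', of "{s}" "\<lambda>U. basis (iso_class U) :: 'd pclass \<Rightarrow>\<^sub>0 'k::field_char_0"] s False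
      by (simp add: attachable_def Psi_basis[OF partitioned_tree_grow[OF T T' s]])
  qed
  finally show ?thesis by (simp add: cp_bullet_basis[OF T T'] is_lin_sum[OF is_lin_Psi])
qed

section \<open>The isomorphism\<close>

lemma CP_trilinear_eqI:
  assumes "\<And>b c. is_lin (\<lambda>a. F a b c)" "\<And>a c. is_lin (\<lambda>b. F a b c)" "\<And>a b. is_lin (F a b)"
    and "\<And>b c. is_lin (\<lambda>a. G a b c)" "\<And>a c. is_lin (\<lambda>b. G a b c)" "\<And>a b. is_lin (G a b)"
    and eq: "\<And>X Y Z. X \<in> PT D \<Longrightarrow> Y \<in> PT D \<Longrightarrow> Z \<in> PT D \<Longrightarrow>
      F (basis X) (basis Y) (basis Z) = G (basis X) (basis Y) (basis Z)"
    and "a \<in> CP D" "b \<in> CP D" "c \<in> CP D"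
  shows "F a b c = G a b c"
proof -
  have keys: "Poly_Mapping.keys a \<subseteq> PT D" "Poly_Mapping.keys b \<subseteq> PT D" "Poly_Mapping.keys c \<subseteq> PT D"
    using assms(8-10) by (simp_all add: CP_def)
  have "F (basis X) (basis Y) c = G (basis X) (basis Y) c" if "X \<in> PT D" "Y \<in> PT D" for X Y
    by (rule is_lin_eqI[OF assms(3,6) keys(3)]) (rule eq[OF that])
  then have "F (basis X) b c = G (basis X) b c" if "X \<in> PT D" for X
    using is_lin_eqI[OF assms(2,5) keys(2)] that by blast
  then show ?thesis using is_lin_eqI[OF assms(1,4) keys(1)] by blast
qed

lemma CP_bilinear_eqI:
  assumes "\<And>b. is_lin (\<lambda>a. F a b)" "\<And>a. is_lin (F a)" "\<And>b. is_lin (\<lambda>a. G a b)" "\<And>a. is_lin (G a)"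
    and "\<And>X Y. X \<in> PT D \<Longrightarrow> Y \<in> PT D \<Longrightarrow> F (basis X) (basis Y) = G (basis X) (basis Y)"
    and "a \<in> CP D" "b \<in> CP D"
  shows "F a b = G a b"
proof -
  have keys: "Poly_Mapping.keys a \<subseteq> PT D" "Poly_Mapping.keys b \<subseteq> PT D"
    using assms(6,7) by (simp_all add: CP_def)
  have "F (basis X) b = G (basis X) b" if "X \<in> PT D" for X
    by (rule is_lin_eqI[OF assms(2,4) keys(2)]) (rule assms(5)[OF that])
  then show ?thesis using is_lin_eqI[OF assms(1,3) keys(1)] by blast
qed

section \<open>Laws of the dot and bullet products on \<open>CP D\<close>\<close>

lemma cp_dot_commute:
  assumes "a \<in> CP D" "b \<in> CP D"
  shows "cp_dot a b = cp_dot b a"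
proof (rule CP_bilinear_eqI[where F = cp_dot and G = "\<lambda>a b. cp_dot b a", OF is_lin_cp(1,2) is_lin_cp(2,1) _ assms])
  fix X Y assume "X \<in> PT D" "Y \<in> PT D"
  then show "cp_dot (basis X) (basis Y) = (cp_dot (basis Y) (basis X) :: 'a pclass \<Rightarrow>\<^sub>0 'b)"
    by (elim PT_E) (simp add: cp_dot_basis, rule arg_cong[where f = basis], rule merge_commute)
qed

lemma cp_dot_assoc:
  assumes "a \<in> CP D" "b \<in> CP D" "c \<in> CP D"
  shows "cp_dot (cp_dot a b) c = cp_dot a (cp_dot b c)"
proof (rule CP_trilinear_eqI[where F = "\<lambda>a b c. cp_dot (cp_dot a b) c"
      and G = "\<lambda>a b c. cp_dot a (cp_dot b c)", OF _ _ _ _ _ _ _ assms])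
  fix X Y Z assume "X \<in> PT D" "Y \<in> PT D" "Z \<in> PT D"
  then show "cp_dot (cp_dot (basis X) (basis Y)) (basis Z) =
      (cp_dot (basis X) (cp_dot (basis Y) (basis Z)) :: 'a pclass \<Rightarrow>\<^sub>0 'b)"
    by (elim PT_E) (simp add: cp_dot_basis merge_assoc partitioned_tree_merge)
qed (rule is_linI; simp add: cp_bilinear)+

lemma leibniz_basis:
  assumes A: "partitioned_tree A" and B: "partitioned_tree B" and C: "partitioned_tree C"
  shows "cp_bullet (cp_dot (basis (iso_class A)) (basis (iso_class B))) (basis (iso_class C)) =
    cp_dot (cp_bullet (basis (iso_class A)) (basis (iso_class C))) (basis (iso_class B)) +
    cp_dot (basis (iso_class A)) (cp_bullet (basis (iso_class B)) (basis (iso_class C)))"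
proof -
  have fin: "finite (verts A)" "finite (verts B)"
    using A B by (auto intro: partitioned_forestD(1) partitioned_treeD)
  show ?thesis
    by (simp add: cp_dot_basis cp_bullet_basis A B C partitioned_tree_merge partitioned_tree_grow
      is_lin_sum[OF is_lin_cp(1)] is_lin_sum[OF is_lin_cp(2)] sum.Plus fin
      grow_merge_left grow_merge_right cong: sum.cong)
qed

lemma cp_leibniz:
  assumes "a \<in> CP D" "b \<in> CP D" "c \<in> CP D"
  shows "cp_bullet (cp_dot a b) c = cp_dot (cp_bullet a c) b + cp_dot a (cp_bullet b c)"
proof (rule CP_trilinear_eqI[where F = "\<lambda>a b c. cp_bullet (cp_dot a b) c"
      and G = "\<lambda>a b c. cp_dot (cp_bullet a c) b + cp_dot a (cp_bullet b c)", OF _ _ _ _ _ _ _ assms])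
  fix X Y Z assume "X \<in> PT D" "Y \<in> PT D" "Z \<in> PT D"
  then show "cp_bullet (cp_dot (basis X) (basis Y)) (basis Z) =
      cp_dot (cp_bullet (basis X) (basis Z)) (basis Y) +
      (cp_dot (basis X) (cp_bullet (basis Y) (basis Z)) :: 'a pclass \<Rightarrow>\<^sub>0 'b)"
    by (elim PT_E) (simp add: leibniz_basis)
qed (rule is_linI; simp add: cp_bilinear scale.scale_right_distrib)+

lemma associator_basis:
  assumes A: "partitioned_tree A" and B: "partitioned_tree B" and C: "partitioned_tree C"
  shows "cp_bullet (cp_bullet (basis (iso_class A)) (basis (iso_class B))) (basis (iso_class C)) -
    cp_bullet (basis (iso_class A)) (cp_bullet (basis (iso_class B)) (basis (iso_class C))) =
    (\<Sum>s\<in>verts A. \<Sum>u\<in>verts A. basis (iso_class (grow (grow A s B) (Inl u) C)))"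
proof -
  have fin: "finite (verts A)" "finite (verts B)"
    using A B by (auto intro: partitioned_forestD(1) partitioned_treeD)
  show ?thesis
    by (simp add: cp_bullet_basis A B C partitioned_tree_grow is_lin_sum[OF is_lin_cp(3)]
      is_lin_sum[OF is_lin_cp(4)] sum.Plus fin sum.distrib grow_grow_above
      sum.swap[of _ "verts B" "verts A"] cong: sum.cong)
qed

lemma cp_prelie:
  assumes "a \<in> CP D" "b \<in> CP D" "c \<in> CP D"
  shows "cp_bullet (cp_bullet a b) c - cp_bullet a (cp_bullet b c) =
    cp_bullet (cp_bullet a c) b - cp_bullet a (cp_bullet c b)"
proof (rule CP_trilinear_eqI[where F = "\<lambda>a b c. cp_bullet (cp_bullet a b) c - cp_bullet a (cp_bullet b c)"
      and G = "\<lambda>a b c. cp_bullet (cp_bullet a c) b - cp_bullet a (cp_bullet c b)", OF _ _ _ _ _ _ _ assms])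
  fix X Y Z assume "X \<in> PT D" "Y \<in> PT D" "Z \<in> PT D"
  then obtain A B C :: "(nat, 'a) pforest" where *: "partitioned_tree A" "partitioned_tree B"
    "partitioned_tree C" "X = iso_class A" "Y = iso_class B" "Z = iso_class C"
    by (elim PT_E) blast
  show "cp_bullet (cp_bullet (basis X) (basis Y)) (basis Z) - cp_bullet (basis X) (cp_bullet (basis Y) (basis Z)) =
      cp_bullet (cp_bullet (basis X) (basis Z)) (basis Y) -
      (cp_bullet (basis X) (cp_bullet (basis Z) (basis Y)) :: 'a pclass \<Rightarrow>\<^sub>0 'b)"
    unfolding *(4-6) associator_basis[OF *(1-3)] associator_basis[OF *(1,3,2)]
    by (subst sum.swap) (simp add: grow_grow_swap[OF *(1,3,2)] cong: sum.cong)
qed (rule is_linI; simp add: cp_bilinear scale.scale_right_diff_distrib)+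

section \<open>Closure of \<open>CP D\<close> and the homomorphism equations\<close>

lemma iso_class_join_in_PT:
  assumes "partitioned_tree T" "partitioned_tree T'" "attachable T S" "B \<in> attach T S"
    "deco T ` verts T \<subseteq> D" "deco T' ` verts T' \<subseteq> D"
  shows "iso_class (join T S B T') \<in> PT D"
  using assms by (intro iso_class_in_PT partitioned_tree_join) auto

lemma is_lin_maps_CP_bilinear:
  assumes "\<And>b. is_lin (\<lambda>a. F a b)" "\<And>a. is_lin (F a)"
    and "\<And>X Y. X \<in> PT D \<Longrightarrow> Y \<in> PT D \<Longrightarrow> F (basis X) (basis Y) \<in> CP D"
    and "a \<in> CP D" "b \<in> CP D"
  shows "F a b \<in> CP D"
  using is_lin_maps_CP[OF assms(1) _ assms(4)] is_lin_maps_CP[OF assms(2) assms(3) assms(5)] by blast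

lemma cp_dot_in_CP: "a \<in> CP D \<Longrightarrow> b \<in> CP D \<Longrightarrow> cp_dot a b \<in> CP D"
  by (erule (1) is_lin_maps_CP_bilinear[OF is_lin_cp(1,2), rotated])
    (elim PT_E, simp add: cp_dot_basis basis_in_CP iso_class_join_in_PT attachable_def attach_def)

lemma cp_bullet_in_CP: "a \<in> CP D \<Longrightarrow> b \<in> CP D \<Longrightarrow> cp_bullet a b \<in> CP D"
  by (erule (1) is_lin_maps_CP_bilinear[OF is_lin_cp(3,4), rotated])
    (elim PT_E, auto simp: cp_bullet_basis attachable_def attach_def
      intro!: scale.subspace_sum[OF subspace_CP] basis_in_CP iso_class_join_in_PT)

lemma cp_diamond_in_CP: "a \<in> CP D \<Longrightarrow> b \<in> CP D \<Longrightarrow> cp_diamond a b \<in> CP D"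
proof (erule (1) is_lin_maps_CP_bilinear[OF is_lin_cp(5,6), rotated])
  fix X Y assume "X \<in> PT D" "Y \<in> PT D"
  then obtain A B :: "(nat, 'a) pforest" where *: "partitioned_tree A" "deco A ` verts A \<subseteq> D"
    "partitioned_tree B" "deco B ` verts B \<subseteq> D" "X = iso_class A" "Y = iso_class B"
    by (elim PT_E) blast
  show "(cp_diamond (basis X) (basis Y) :: 'a pclass \<Rightarrow>\<^sub>0 'b) \<in> CP D"
  proof (cases "verts B = {}")
    case True
    then show ?thesis
      using \<open>X \<in> PT D\<close> unfolding *(5,6) cp_diamond_basis_empty[OF *(1,3) True]
      by (intro scale.subspace_scale[OF subspace_CP] basis_in_CP)
  next
    case False
    then show ?thesis
      unfolding *(5,6) cp_diamond_basis[OF *(1,3) False] using *(1-4)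
      by (intro scale.subspace_sum[OF subspace_CP] basis_in_CP iso_class_join_in_PT)
        (auto simp: attachable_def)
  qed
qed

lemma Psi_in_CP: "x \<in> CP D \<Longrightarrow> Psi x \<in> CP D"
  by (erule is_lin_maps_CP[OF is_lin_Psi, rotated])
    (elim PT_E, auto simp: Psi_basis
      intro!: scale.subspace_sum[OF subspace_CP] basis_in_CP iso_class_in_PT partitioned_tree_blocks)

lemma Psi_dot:
  assumes "a \<in> CP D" "b \<in> CP D"
  shows "Psi (cp_dot a b) = cp_dot (Psi a) (Psi b)"
proof (rule CP_bilinear_eqI[where F = "\<lambda>a b. Psi (cp_dot a b)" and G = "\<lambda>a b. cp_dot (Psi a) (Psi b)", OF _ _ _ _ _ assms])
  fix X Y assume "X \<in> PT D" "Y \<in> PT D"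
  then show "Psi (cp_dot (basis X) (basis Y)) =
      (cp_dot (Psi (basis X)) (Psi (basis Y)) :: 'a pclass \<Rightarrow>\<^sub>0 'b)"
    by (elim PT_E) (simp add: Psi_dot_basis)
qed (rule is_linI; simp add: cp_bilinear is_lin_add[OF is_lin_Psi] is_lin_scale[OF is_lin_Psi])+

lemma Psi_bullet:
  assumes "a \<in> CP D" "b \<in> CP D"
  shows "Psi (cp_bullet a b) = cp_diamond (Psi a) (Psi b)"
proof (rule CP_bilinear_eqI[where F = "\<lambda>a b. Psi (cp_bullet a b)" and G = "\<lambda>a b. cp_diamond (Psi a) (Psi b)", OF _ _ _ _ _ assms])
  fix X Y assume "X \<in> PT D" "Y \<in> PT D"
  then show "Psi (cp_bullet (basis X) (basis Y)) =
      (cp_diamond (Psi (basis X)) (Psi (basis Y)) :: 'a pclass \<Rightarrow>\<^sub>0 'b)"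
    by (elim PT_E) (simp add: Psi_bullet_basis)
qed (rule is_linI; simp add: cp_bilinear is_lin_add[OF is_lin_Psi] is_lin_scale[OF is_lin_Psi])+

section \<open>Unitriangularity and bijectivity of \<open>Psi\<close>\<close>

lemma card_coarsening:
  assumes fin: "finite P" and "refines A P Q" and "Q \<noteq> P"
  shows "card Q < card P"
proof -
  have P: "partition_on A P" and Q: "partition_on A Q" and ref: "\<forall>X\<in>P. \<exists>Y\<in>Q. X \<subseteq> Y"
    using assms(2) by (auto simp: refines_def)
  \<comment> \<open>\<open>h\<close> sends each block of \<open>P\<close> to the block of
    \<open>Q\<close> around it; it is onto because every block of \<open>Q\<close> is nonempty and
    its elements lie in blocks of \<open>P\<close>.\<close>
  define h where "h X = (SOME Y. Y \<in> Q \<and> X \<subseteq> Y)" for X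
  have h: "h X \<in> Q" "X \<subseteq> h X" if "X \<in> P" for X
    using someI_ex[of "\<lambda>Y. Y \<in> Q \<and> X \<subseteq> Y"] ref that unfolding h_def by blast+
  have cover: "\<exists>X\<in>P. x \<in> X \<and> h X = Y" if Y: "Y \<in> Q" "x \<in> Y" for x Y
  proof -
    obtain X where X: "X \<in> P" "x \<in> X"
      using partition_onD1[OF P] partition_onD1[OF Q] Y by blast
    moreover have "h X = Y"
      using partition_block_eq[OF Q, of Y "h X" x] h[OF X(1)] X(2) Y by auto
    ultimately show ?thesis by blast
  qed
  have ne: "Y \<noteq> {}" if "Y \<in> Q" for Y using Q that by (auto simp: partition_on_def)
  have "Q \<subseteq> h ` P"
  proof
    fix Y assume Y: "Y \<in> Q"
    then obtain y where "y \<in> Y" using ne by blast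
    then show "Y \<in> h ` P" using cover[OF Y] by blast
  qed
  then have img: "h ` P = Q" using h(1) by blast
  then have le: "card Q \<le> card P" using card_image_le[OF fin, of h] by simp
  \<comment> \<open>Equal cardinalities would make \<open>h\<close> injective, so every block of
    \<open>Q\<close> would contain just one block of \<open>P\<close> and hence equal it,
    contradicting \<open>Q \<noteq> P\<close>.\<close>
  have "card Q \<noteq> card P"
  proof
    assume "card Q = card P"
    then have inj: "inj_on h P" using eq_card_imp_inj_on[OF fin, of h] img by simp
    have "h X = X" if X: "X \<in> P" for X
    proof
      show "X \<subseteq> h X" by (rule h(2)[OF X])
      show "h X \<subseteq> X"
      proof
        fix x assume "x \<in> h X"
        then obtain Z where "Z \<in> P" "x \<in> Z" "h Z = h X" using cover[OF h(1)[OF X]] by blast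
        then show "x \<in> X" using inj_onD[OF inj _ _ X] by auto
      qed
    qed
    then show False using img \<open>Q \<noteq> P\<close> by simp
  qed
  with le show ?thesis by simp
qed

text \<open>The measure with respect to which \<open>Psi\<close> is unitriangular;
  \<open>nblocks_iso_class\<close> frees it from the chosen representative.\<close>

definition nblocks :: "'d pclass \<Rightarrow> nat" where
  "nblocks X = card (blocks (rep X))"

lemma nblocks_iso_class:
  assumes "partitioned_tree T"
  shows "nblocks (iso_class T) = card (blocks T)"
proof -
  obtain f where f: "iso_by f T (rep (iso_class T))" by (rule rep_E[OF assms])
  then have "inj_on f (verts T)" "blocks (rep (iso_class T)) = (`) f ` blocks T"
    by (simp_all add: iso_by_def bij_betw_def)
  moreover have "blocks T \<subseteq> Pow (verts T)"
    using partitioned_forestD(7)[OF partitioned_treeD[OF assms]] by auto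
  ultimately show ?thesis
    unfolding nblocks_def by (metis card_image inj_on_image_Pow inj_on_subset)
qed

text \<open>The trivial coarsening \<open>blocks T\<close> supplies the leading term. All others
  have strictly fewer blocks by \<open>card_coarsening\<close>, so none of them can be isomorphic to
  \<open>T\<close> and alter its coefficient one.\<close>

lemma Psi_basis_triangular:
  assumes X: "X \<in> PT D"
  shows "\<exists>R. Psi (basis X) = basis X + R \<and> R \<in> CP D \<and> (\<forall>Y\<in>Poly_Mapping.keys R. nblocks Y < nblocks X)"
proof -
  obtain T :: "(nat, 'a) pforest" where T: "partitioned_tree T" "deco T ` verts T \<subseteq> D" "X = iso_class T"
    using X by (rule PT_E)
  note P = partitioned_forestD[OF partitioned_treeD[OF T(1)]]
  let ?C = "coarsenings T - {blocks T}"
  define R :: "'a pclass \<Rightarrow>\<^sub>0 'b" where "R = (\<Sum>J\<in>?C. basis (iso_class (T\<lparr>blocks := J\<rparr>)))"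
  have "blocks T \<in> coarsenings T"
    using P(4) P(6) refines_refl unfolding coarsenings_def mem_Collect_eq by blast
  then have "Psi (basis X) = basis X + R"
    by (simp add: T(3) Psi_basis[OF T(1)] R_def sum.remove[OF finite_coarsenings[OF partitioned_treeD[OF T(1)]]])
  moreover have "R \<in> CP D"
    unfolding R_def using T(2) by (intro scale.subspace_sum[OF subspace_CP] basis_in_CP iso_class_in_PT
        partitioned_tree_blocks[OF T(1)]) auto
  moreover have "nblocks Y < nblocks X" if Y: "Y \<in> Poly_Mapping.keys R" for Y
  proof -
    have "Y \<in> (\<Union>J\<in>?C. Poly_Mapping.keys (basis (iso_class (T\<lparr>blocks := J\<rparr>)) :: 'a pclass \<Rightarrow>\<^sub>0 'b))"
      using Y keys_sum[of "\<lambda>J. basis (iso_class (T\<lparr>blocks := J\<rparr>)) :: 'a pclass \<Rightarrow>\<^sub>0 'b" ?C]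
      unfolding R_def by blast
    then obtain J where J: "J \<in> coarsenings T" "J \<noteq> blocks T" "Y = iso_class (T\<lparr>blocks := J\<rparr>)"
      by (auto simp: basis_def)
    have "finite (blocks T)" using P(1,7) by (auto intro: finite_subset[of _ "Pow (verts T)"])
    from card_coarsening[OF this, of "verts T" J] J
    show ?thesis
      by (simp add: T(3) nblocks_iso_class[OF T(1)] nblocks_iso_class[OF partitioned_tree_blocks[OF T(1) J(1)]]
        coarsenings_def)
  qed
  ultimately show ?thesis by blast
qed

text \<open>Among the finitely many classes occurring in \<open>x\<close>, take one with the most
  blocks. The remainders contributed by the occurring classes involve only fewer blocks, so its
  coefficient is the same in \<open>Psi x\<close> as in \<open>x\<close>.\<close>

lemma Psi_eq_0D:
  assumes x: "x \<in> CP D" and "Psi x = 0"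
  shows "x = 0"
proof (rule ccontr)
  let ?K = "Poly_Mapping.keys x"
  assume "x \<noteq> 0"
  then have "nblocks ` ?K \<noteq> {}" by simp
  from Max_in[OF _ this] obtain X where X: "X \<in> ?K" "nblocks X = Max (nblocks ` ?K)" by auto
  then have max: "nblocks Y \<le> nblocks X" if "Y \<in> ?K" for Y using that by simp
  have lookup: "Poly_Mapping.lookup (Psi (basis Y)) X = (if Y = X then 1 else (0 :: 'b))" if Y: "Y \<in> ?K" for Y
  proof -
    have "Y \<in> PT D" using Y x by (auto simp: CP_def)
    then obtain R :: "'a pclass \<Rightarrow>\<^sub>0 'b" where R: "Psi (basis Y) = basis Y + R"
      "\<forall>Z\<in>Poly_Mapping.keys R. nblocks Z < nblocks Y"
      using Psi_basis_triangular by blast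
    have "X \<notin> Poly_Mapping.keys R" using R(2) max[OF Y] by auto
    then show ?thesis
      unfolding R(1) by (simp add: lookup_add basis_def lookup_single in_keys_iff when_def)
  qed
  have "Poly_Mapping.lookup (Psi x) X =
      (\<Sum>Y\<in>?K. Poly_Mapping.lookup x Y * Poly_Mapping.lookup (Psi (basis Y)) X)"
    by (subst is_lin_expand[OF is_lin_Psi]) (simp add: lookup_sum lookup_scale)
  also have "\<dots> = (\<Sum>Y\<in>?K. if Y = X then Poly_Mapping.lookup x X else 0)"
    by (rule sum.cong[OF refl]) (simp add: lookup)
  also have "\<dots> = Poly_Mapping.lookup x X" using X(1) by simp
  finally show False using assms(2) X(1) by (simp add: in_keys_iff)
qed

text \<open>Strong induction on the number of blocks: the remainder of \<open>Psi (basis X)\<close>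
  involves only classes with fewer blocks, which have preimages, and these are subtracted from
  \<open>basis X\<close>.\<close>

lemma basis_in_range_Psi:
  assumes "X \<in> PT D"
  shows "basis X \<in> Psi ` CP D"
  using assms
proof (induction "nblocks X" arbitrary: X rule: less_induct)
  case less
  obtain R :: "'a pclass \<Rightarrow>\<^sub>0 'b" where R: "Psi (basis X) = basis X + R" "R \<in> CP D"
    "\<forall>Y\<in>Poly_Mapping.keys R. nblocks Y < nblocks X"
    using Psi_basis_triangular[OF less.prems] by blast
  have "\<forall>Y\<in>Poly_Mapping.keys R. \<exists>y. y \<in> CP D \<and> Psi y = (basis Y :: 'a pclass \<Rightarrow>\<^sub>0 'b)"
  proof
    fix Y assume Y: "Y \<in> Poly_Mapping.keys R"
    then have "Y \<in> PT D" using R(2) by (auto simp: CP_def)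
    then have "(basis Y :: 'a pclass \<Rightarrow>\<^sub>0 'b) \<in> Psi ` CP D" using less.hyps R(3) Y by blast
    then show "\<exists>y. y \<in> CP D \<and> Psi y = (basis Y :: 'a pclass \<Rightarrow>\<^sub>0 'b)" by (metis imageE)
  qed
  then obtain p where p: "\<And>Y. Y \<in> Poly_Mapping.keys R \<Longrightarrow> p Y \<in> CP D \<and> Psi (p Y) = (basis Y :: 'a pclass \<Rightarrow>\<^sub>0 'b)"
    by metis
  define r where "r = (\<Sum>Y\<in>Poly_Mapping.keys R. scale (Poly_Mapping.lookup R Y) (p Y))"
  have "r \<in> CP D" unfolding r_def
    using p by (intro scale.subspace_sum[OF subspace_CP] scale.subspace_scale[OF subspace_CP]) auto
  moreover have "Psi r = R"
    unfolding r_def is_lin_sum[OF is_lin_Psi] is_lin_scale[OF is_lin_Psi]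
    by (subst (2) basis_expansion[of R]) (simp add: p)
  ultimately have "basis X - r \<in> CP D" "Psi (basis X - r) = basis X"
    using R(1) basis_in_CP[OF less.prems]
    by (auto simp: is_lin_diff[OF is_lin_Psi] intro: scale.subspace_diff[OF subspace_CP])
  then show ?case by (metis imageI)
qed

lemma bij_betw_Psi:
  fixes D :: "'d set"
  shows "bij_betw Psi (CP D) (CP D :: ('d pclass \<Rightarrow>\<^sub>0 'k::field_char_0) set)"
  unfolding bij_betw_def
proof
  show "inj_on Psi (CP D)"
  proof (rule inj_onI)
    fix x y assume "x \<in> CP D" "y \<in> CP D" "Psi x = Psi y"
    then have "x - y \<in> CP D" "Psi (x - y) = 0"
      by (auto simp: is_lin_diff[OF is_lin_Psi] intro: scale.subspace_diff[OF subspace_CP])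
    from Psi_eq_0D[OF this] show "x = y" by simp
  qed
  show "Psi ` CP D = (CP D :: ('d pclass \<Rightarrow>\<^sub>0 'k) set)"
  proof (intro equalityI subsetI)
    fix x :: "'d pclass \<Rightarrow>\<^sub>0 'k" assume x: "x \<in> CP D"
    have "\<forall>Y\<in>Poly_Mapping.keys x. \<exists>y. y \<in> CP D \<and> Psi y = (basis Y :: 'd pclass \<Rightarrow>\<^sub>0 'k)"
    proof
      fix Y assume "Y \<in> Poly_Mapping.keys x"
      then have "Y \<in> PT D" using x by (auto simp: CP_def)
      then show "\<exists>y. y \<in> CP D \<and> Psi y = (basis Y :: 'd pclass \<Rightarrow>\<^sub>0 'k)"
        by (metis basis_in_range_Psi imageE)
    qed
    then obtain p where p: "\<And>Y. Y \<in> Poly_Mapping.keys x \<Longrightarrow> p Y \<in> CP D \<and> Psi (p Y) = (basis Y :: 'd pclass \<Rightarrow>\<^sub>0 'k)"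
      by metis
    let ?r = "\<Sum>Y\<in>Poly_Mapping.keys x. scale (Poly_Mapping.lookup x Y) (p Y)"
    have r: "?r \<in> CP D"
      using p by (intro scale.subspace_sum[OF subspace_CP] scale.subspace_scale[OF subspace_CP]) auto
    have eq: "Psi ?r = x"
      unfolding is_lin_sum[OF is_lin_Psi] is_lin_scale[OF is_lin_Psi]
      by (subst (2) basis_expansion[of x]) (simp add: p)
    show "x \<in> Psi ` CP D" using imageI[OF r, of Psi] unfolding eq .
  qed (use Psi_in_CP in blast)
qed

section \<open>The two Com-PreLie structures and the isomorphism\<close>

lemma com_prelie_algebra_bullet: "com_prelie_algebra scale (CP D) cp_dot cp_bullet"
  by unfold_locales
    (rule subspace_CP cp_bilinear | erule (2) cp_dot_assoc cp_leibniz cp_prelie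
      | erule (1) cp_dot_in_CP cp_bullet_in_CP cp_dot_commute)+

text \<open>Bilinearity, closure and the laws of the dot product are available directly. Only the
  pre-Lie and Leibniz laws are carried over, with the surjectivity of \<open>Psi\<close> supplying
  preimages.\<close>

lemma com_prelie_algebra_diamond:
  fixes D :: "'d set"
  shows "com_prelie_algebra scale (CP D) cp_dot
    (cp_diamond :: ('d pclass \<Rightarrow>\<^sub>0 'k::field_char_0) \<Rightarrow> _)"
proof
  fix a b c :: "'d pclass \<Rightarrow>\<^sub>0 'k" assume "a \<in> CP D" "b \<in> CP D" "c \<in> CP D"
  then have "a \<in> Psi ` CP D" "b \<in> Psi ` CP D" "c \<in> Psi ` CP D"
    by (simp_all add: bij_betw_imp_surj_on[OF bij_betw_Psi])
  then obtain a' b' c' where c: "a' \<in> CP D" "b' \<in> CP D" "c' \<in> CP D" and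
    eq: "a = Psi a'" "b = Psi b'" "c = Psi c'" by (elim imageE)
  \<comment> \<open>Read from right to left, the homomorphism equations pull \<open>Psi\<close>
    outwards until each side is \<open>Psi\<close> of the corresponding side for
    \<open>cp_bullet\<close>.\<close>
  note hom = Psi_dot[symmetric, where D = D] Psi_bullet[symmetric, where D = D] cp_dot_in_CP cp_bullet_in_CP
    is_lin_add[OF is_lin_Psi, symmetric] is_lin_diff[OF is_lin_Psi, symmetric]
  show "cp_diamond (cp_diamond a b) c - cp_diamond a (cp_diamond b c) =
      cp_diamond (cp_diamond a c) b - cp_diamond a (cp_diamond c b)"
    unfolding eq using cp_prelie[OF c] by (simp add: hom c)
  show "cp_diamond (cp_dot a b) c = cp_dot (cp_diamond a c) b + cp_dot a (cp_diamond b c)"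
    unfolding eq using cp_leibniz[OF c] by (simp add: hom c)
qed (rule subspace_CP cp_bilinear | erule (2) cp_dot_assoc
  | erule (1) cp_dot_in_CP cp_diamond_in_CP cp_dot_commute)+

theorem theorem4p17:
  fixes D :: "'d set"
  shows "com_prelie_isomorphism
    scale (CP D) cp_dot cp_bullet
    scale (CP D) cp_dot cp_diamond
    (Psi :: ('d pclass \<Rightarrow>\<^sub>0 'k::field_char_0) \<Rightarrow> ('d pclass \<Rightarrow>\<^sub>0 'k))"
proof (intro com_prelie_isomorphism.intro com_prelie_isomorphism_axioms.intro)
  show "bij_betw Psi (CP D) (CP D :: ('d pclass \<Rightarrow>\<^sub>0 'k) set)" by (rule bij_betw_Psi)
qed (rule com_prelie_algebra_bullet com_prelie_algebra_diamond is_lin_add[OF is_lin_Psi]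
  is_lin_scale[OF is_lin_Psi] | erule (1) Psi_dot Psi_bullet)+

end
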